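(* Let $k>\ell\ge 0$ and let $\lambda$ be a frequency. Then there is a constant $C=C(k,\ell,\lambda)>0$ such that for all $f\in H_{\infty,\ell}^{\lambda}[\mathrm{Re}>0]$ $$\sup_{x>0}\|R_x^{\lambda,k}(f)\|_{\infty,\ell}\le C\,\|f\|_{\infty,\ell}.$$ In particular, for every $\sigma\ge 0$ there is a constant $C=C(\ell,k,\lambda,\sigma)>0$ such that for every $f\in H_{\infty,\ell}^{\lambda}[\mathrm{Re}>0]$ and every $t\in\mathbb{R}$ $$\sup_{x>0}|R_x^{\lambda,k}(f)(\sigma+it)|\le C(1+|t|)^{\ell}\,\|f\|_{\infty,\ell}.$$
   Context: A frequency is a strictly increasing sequence $\lambda=(\lambda_n)_{n\ge 1}$ of non-negative real numbers with $\lambda_n\to\infty$. A $\lambda$-Dirichlet series is a formal series $D=\sum a_n e^{-\lambda_n s}$ with complex coefficients $a_n$. Write $[\mathrm{Re}>\sigma]=\{s\in\mathbb{C}:\mathrm{Re}\,s>\sigma\}$. A $\lambda$-Dirichlet series $D=\sum a_ne^{-\lambda_ns}$ is a $\lambda$-Riesz germ of a holomorphic function $f:[\mathrm{Re}>0]\to\mathbb{C}$ if for some $m\ge 0$ and some $\sigma\ge 0$ one has $f(s)=\lim_{x\to\infty}\sum_{\lambda_n<x}a_ne^{-\lambda_ns}\big(1-\frac{\lambda_n}{x}\big)^m$ for all $s\in[\mathrm{Re}>\sigma]$. A $\lambda$-Riesz germ, if it exists, is unique, and one writes $a_n(f):=a_n$. For such $f$, $k\ge 0$, $x>0$ and $s\in\mathbb{C}$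 put $R_x^{\lambda,k}(f)(s)=\sum_{\lambda_n<x}a_n(f)e^{-\lambda_ns}\big(1-\frac{\lambda_n}{x}\big)^k$. For $\ell\ge 0$, $H_{\infty,\ell}^{\lambda}[\mathrm{Re}>0]$ is the linear space of all holomorphic $f:[\mathrm{Re}>0]\to\mathbb{C}$ which have a $\lambda$-Riesz germ and satisfy $\|f\|_{\infty,\ell}=\sup_{\mathrm{Re}\,s>0}\frac{|f(s)|}{(1+|s|)^{\ell}}<\infty$. *)

theory Defs
  imports "HOL-Complex_Analysis.Complex_Analysis"
begin

text \<open>Frequencies and coefficient sequences are indexed from 0 instead of from 1. A formal
  Dirichlet series over the frequency \<open>lam\<close> is represented by its coefficient sequence \<open>a\<close>.\<close>

definition frequency :: "(nat \<Rightarrow> real) \<Rightarrow> bool" where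
  "frequency lam \<longleftrightarrow> strict_mono lam \<and> (\<forall>n. 0 \<le> lam n) \<and> filterlim lam at_top sequentially"

abbreviation right_half_plane :: "real \<Rightarrow> complex set" where
  "right_half_plane \<sigma> \<equiv> {s. Re s > \<sigma>}"

text \<open>For a frequency the index set is finite for every \<open>x\<close>. For \<open>x > 0\<close> the base of \<open>powr\<close> is
  positive, so that order 0 gives the plain partial sum.\<close>

definition riesz_mean ::
  "(nat \<Rightarrow> real) \<Rightarrow> real \<Rightarrow> (nat \<Rightarrow> complex) \<Rightarrow> real \<Rightarrow> complex \<Rightarrow> complex" where
  "riesz_mean lam k a x s =
     (\<Sum>n | lam n < x. a n * exp (- of_real (lam n) * s) * of_real ((1 - lam n / x) powr k))"

definition riesz_germ ::
  "(nat \<Rightarrow> real) \<Rightarrow> (nat \<Rightarrow> complex) \<Rightarrow> (complex \<Rightarrow> complex) \<Rightarrow> bool" where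
  "riesz_germ lam a f \<longleftrightarrow>
     f holomorphic_on right_half_plane 0 \<and>
     (\<exists>m\<ge>0. \<exists>\<sigma>\<ge>0. \<forall>s\<in>right_half_plane \<sigma>.
        ((\<lambda>x. riesz_mean lam m a x s) \<longlongrightarrow> f s) at_top)"

text \<open>The description is proper since a Riesz germ of \<open>f\<close>, if it exists, is unique when \<open>lam\<close> is a
  frequency.\<close>

definition riesz_coeff :: "(nat \<Rightarrow> real) \<Rightarrow> (complex \<Rightarrow> complex) \<Rightarrow> nat \<Rightarrow> complex" where
  "riesz_coeff lam f = (THE a. riesz_germ lam a f)"

definition R_mean :: "(nat \<Rightarrow> real) \<Rightarrow> real \<Rightarrow> real \<Rightarrow> (complex \<Rightarrow> complex) \<Rightarrow> complex \<Rightarrow> complex" where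
  "R_mean lam k x f s = riesz_mean lam k (riesz_coeff lam f) x s"

text \<open>The value lies in \<^typ>\<open>ennreal\<close>: it is \<open>\<infinity>\<close> if the quotient is unbounded.\<close>

definition H_norm :: "real \<Rightarrow> (complex \<Rightarrow> complex) \<Rightarrow> ennreal" where
  "H_norm l f = (SUP s\<in>right_half_plane 0. ennreal (cmod (f s) / (1 + cmod s) powr l))"

definition H_space :: "(nat \<Rightarrow> real) \<Rightarrow> real \<Rightarrow> (complex \<Rightarrow> complex) set" where
  "H_space lam l =
     {f. f holomorphic_on right_half_plane 0 \<and> (\<exists>a. riesz_germ lam a f) \<and> H_norm l f < \<infinity>}"

end

(*
A Perron formula expresses the Riesz sum \<Sum> a_n (y - \<lambda>_n)^k, up to a non-zero constant, as the integral of
f(s) e^(ys) s^(-k-1) over any vertical line Re s = c > 0. On the line c = 1/y, rescaling s by y bounds this integral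
by y^k times the norm of f, because the growth exponent l of f is smaller than k; this is the estimate at the point 0.
For a point w one applies it to f(s + w), whose norm is at most (1 + |w|)^l times that of f.

To obtain the formula from the mere convergence of some Riesz means of f in some half plane, the order of the means is
first raised to an integer N. By Taylor's formula the means are then dominated by a power of |s| on vertical
lines, which permits a passage to the limit when k > N + 1. Smaller orders follow by differentiating in y. The same
formula shows that the germ of f is unique.
*)

theory Submission
  imports Defs "HOL-Probability.Probability"
begin

text \<open>Two growth exponents compete. The Taylor estimate costs \<open>N + 1\<close> powers of
  |s|, so the limit under the integral is available only above order \<open>N + 1\<close>. The
  descent takes place after that limit, on the integral of \<open>f\<close> itself, where only the
  exponent \<open>l < k\<close> counts; this is why it can pass below \<open>N + 1\<close>.

  The Perron constant is classically 2 pi / Gamma(k + 1). Its value is never computed: that it does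
  not vanish comes from a Fourier argument, and the relation between consecutive orders falls out of
  the descent applied to the constant function 1.

  The estimate at 0 is not uniform as y tends to 0, since rescaling produces the factor (1 + 1/y)^l.
  It is used only for y at least the second frequency \<open>lam 1\<close>; for smaller y at most
  one term remains, and its coefficient is controlled by the mean at \<open>lam 1\<close>. In this
  way the constant comes to depend on the first two frequencies.\<close>

section \<open>Integrals over vertical lines\<close>

lemma integrable_one_plus_abs_powr:
  assumes "p > (1::real)"
  shows "integrable lborel (\<lambda>t::real. (1 + \<bar>t\<bar>) powr - p)"
proof -
  have *: "((\<lambda>x::real. (1 + x) powr (1 - p) / (1 - p)) \<longlongrightarrow> 0) at_top"
  proof -
    have lim: "((\<lambda>x::real. (1 + x) powr (1 - p)) \<longlongrightarrow> 0) at_top"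
      by (rule tendsto_neg_powr)
        (use assms in \<open>auto intro: filterlim_tendsto_add_at_top[OF tendsto_const filterlim_ident]\<close>)
    show ?thesis
      using tendsto_divide[OF lim tendsto_const, of "1 - p"] assms by simp
  qed
  have "(\<integral>\<^sup>+x. ennreal ((1 + x) powr - p) * indicator {0..} x \<partial>lborel)
      = ennreal (0 - (1 + 0) powr (1 - p) / (1 - p))"
  proof (rule nn_integral_FTC_atLeast[OF _ _ _ *])
    fix x :: real assume "0 \<le> x"
    then show "((\<lambda>x. (1 + x) powr (1 - p) / (1 - p)) has_real_derivative (1 + x) powr - p) (at x)"
      using assms by (auto intro!: derivative_eq_intros)
  qed auto
  then have "(\<integral>\<^sup>+x. ennreal (indicator {0..} x *\<^sub>R (1 + \<bar>x\<bar>) powr - p) \<partial>lborel) = ennreal (1 / (p - 1))"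
    using assms
    by (subst (asm) nn_integral_cong[where v = "\<lambda>x. ennreal (indicator {0..} x *\<^sub>R (1 + \<bar>x\<bar>) powr - p)"])
      (auto split: split_indicator simp: divide_simps)
  then have "has_bochner_integral lborel (\<lambda>x::real. indicator {0..} x *\<^sub>R (1 + \<bar>x\<bar>) powr - p) (1 / (p - 1))"
    using assms by (intro has_bochner_integral_nn_integral) auto
  from has_bochner_integral_even_function[OF this] show ?thesis
    by (auto simp: has_bochner_integral_iff)
qed

text \<open>Both \<open>min 1 c\<close> and \<open>min 1 c\<close> times |Im s| are at most
  \<open>cmod s\<close>; the factor 1/2 averages the two bounds. It converts decay in |s| into decay
  in 1 + |Im s|, uniformly for \<open>c \<le> Re s\<close>.\<close>

lemma one_plus_abs_le_cmod:
  assumes "0 < c" "c \<le> Re s"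
  shows "min 1 c / 2 * (1 + \<bar>Im s\<bar>) \<le> cmod s"
proof -
  have "\<bar>Im s\<bar> \<le> cmod s" "Re s \<le> cmod s"
    by (auto simp: abs_Im_le_cmod complex_Re_le_cmod)
  moreover have "min 1 c * \<bar>Im s\<bar> \<le> 1 * \<bar>Im s\<bar>"
    by (intro mult_right_mono) auto
  ultimately show ?thesis
    using assms by (auto simp: distrib_left)
qed

lemma cmod_powr_le:
  assumes "0 < c" "c \<le> Re s" "0 \<le> p"
  shows "cmod s powr - p \<le> (min 1 c / 2) powr - p * (1 + \<bar>Im s\<bar>) powr - p"
proof -
  have "cmod s powr - p \<le> (min 1 c / 2 * (1 + \<bar>Im s\<bar>)) powr - p"
    using assms one_plus_abs_le_cmod[OF assms(1,2)]
    by (intro powr_mono2') (auto intro!: mult_pos_pos)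
  also have "\<dots> = (min 1 c / 2) powr - p * (1 + \<bar>Im s\<bar>) powr - p"
    by (rule powr_mult)
  finally show ?thesis .
qed

lemma continuous_vline:
  assumes "continuous_on (right_half_plane 0) F" "c > 0"
  shows "continuous_on UNIV (\<lambda>t. F (Complex c t))"
proof (rule continuous_on_compose2[OF assms(1)])
  show "continuous_on UNIV (Complex c)"
    by (rule continuous_on_Complex) auto
qed (use assms in auto)

lemma measurable_vline:
  assumes "continuous_on (right_half_plane 0) F" "c > 0"
  shows "(\<lambda>t. F (Complex c t)) \<in> borel_measurable borel"
  using continuous_vline[OF assms] by (rule borel_measurable_continuous_onI)

lemma integrable_vline:
  assumes "continuous_on (right_half_plane 0) F" "c > 0" "p > 1"
    "\<And>t. cmod (F (Complex c t)) \<le> B * (1 + \<bar>t\<bar>) powr - p"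
  shows "integrable lborel (\<lambda>t. F (Complex c t))"
  by (rule Bochner_Integration.integrable_bound[OF integrable_mult_right[OF integrable_one_plus_abs_powr[OF \<open>p > 1\<close>], of B]])
    (use measurable_vline[OF assms(1,2)] assms(4) in \<open>auto intro: order_trans[OF _ abs_ge_self]\<close>)

text \<open>A primitive of \<open>F\<close> turns both truncated integrals into boundary values, which agree up to the
  small contribution of the horizontal edges.\<close>

lemma vline_integral_shift:
  assumes hol: "F holomorphic_on right_half_plane 0" and ab: "0 < a" "a \<le> b" and p: "p > 1"
    and bd: "\<And>s. a \<le> Re s \<Longrightarrow> Re s \<le> b \<Longrightarrow> cmod (F s) \<le> B * (1 + \<bar>Im s\<bar>) powr - p"
  shows "(LINT t|lborel. F (Complex a t)) = (LINT t|lborel. F (Complex b t))"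
proof -
  have op: "open (right_half_plane 0)" and cv: "convex (right_half_plane 0)"
    by (auto simp: open_halfspace_Re_gt convex_halfspace_Re_gt)
  have cont: "continuous_on (right_half_plane 0) F"
    using hol by (rule holomorphic_on_imp_continuous_on)
  obtain G where G': "\<And>x. x \<in> right_half_plane 0 \<Longrightarrow> (G has_field_derivative F x) (at x within right_half_plane 0)"
    using holomorphic_convex_primitive'[OF cv op hol] by blast
  then have G: "(G has_field_derivative F x) (at x)" if "Re x > 0" for x
    using that at_within_open[OF _ op] by force
  have seg: "(LINT t|lborel. indicator {-T..T} t *\<^sub>R F (Complex c t))
      = (G (Complex c T) - G (Complex c (-T))) / \<i>" if "c > 0" "T \<ge> 0" for c T
  proof -
    have "(LINT t|lborel. indicator {-T..T} t *\<^sub>R F (Complex c t))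
      = G (Complex c T) / \<i> - G (Complex c (-T)) / \<i>"
    proof (rule integral_FTC_atLeastAtMost)
      fix t
      have "((\<lambda>t. Complex c t) has_vector_derivative \<i>) (at t)"
        unfolding Complex_eq by (auto intro!: derivative_eq_intros)
      from field_vector_diff_chain_at[OF this G[of "Complex c t"]] that
      have "((\<lambda>t. G (Complex c t)) has_vector_derivative \<i> * F (Complex c t)) (at t)"
        by (simp add: o_def)
      then have "((\<lambda>t. G (Complex c t) / \<i>) has_vector_derivative (\<i> * F (Complex c t)) / \<i>) (at t)"
        unfolding divide_inverse by (rule has_vector_derivative_mult_left)
      then show "((\<lambda>t. G (Complex c t) / \<i>) has_vector_derivative F (Complex c t)) (at t within {-T..T})"
        by (rule has_vector_derivative_at_within[THEN has_vector_derivative_eq_rhs]) simp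
      show "continuous_on {-T..T} (\<lambda>t. F (Complex c t))"
        using continuous_vline[OF cont] that continuous_on_subset by blast
    qed (use that in auto)
    then show ?thesis by (simp only: diff_divide_distrib)
  qed
  have lim: "(\<lambda>n. LINT t|lborel. indicator {- real n..real n} t *\<^sub>R F (Complex c t))
      \<longlonglongrightarrow> (LINT t|lborel. F (Complex c t))" if "a \<le> c" "c \<le> b" for c
  proof (rule integral_dominated_convergence)
    show "integrable lborel (\<lambda>t. B * (1 + \<bar>t\<bar>) powr - p)"
      by (intro integrable_mult_right integrable_one_plus_abs_powr p)
    have m: "(\<lambda>t. F (Complex c t)) \<in> borel_measurable borel"
      using measurable_vline[OF cont] that ab by auto
    then show "(\<lambda>t. F (Complex c t)) \<in> borel_measurable lborel" by simp
    show "(\<lambda>t. indicator {- real n..real n} t *\<^sub>R F (Complex c t)) \<in> borel_measurable lborel" for n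
      using m by simp
    show "AE t in lborel. (\<lambda>n. indicator {- real n..real n} t *\<^sub>R F (Complex c t)) \<longlonglongrightarrow> F (Complex c t)"
    proof (rule AE_I2)
      fix t :: real
      have "\<forall>\<^sub>F n in sequentially. indicator {- real n..real n} t *\<^sub>R F (Complex c t) = F (Complex c t)"
        using eventually_ge_at_top[of "nat \<lceil>\<bar>t\<bar>\<rceil>"]
      proof eventually_elim
        case (elim n)
        then have "\<bar>t\<bar> \<le> real n" by linarith
        then show ?case by (auto simp: indicator_def)
      qed
      then show "(\<lambda>n. indicator {- real n..real n} t *\<^sub>R F (Complex c t)) \<longlonglongrightarrow> F (Complex c t)"
        by (rule tendsto_eventually)
    qed
    show "AE t in lborel. norm (indicator {- real n..real n} t *\<^sub>R F (Complex c t)) \<le> B * (1 + \<bar>t\<bar>) powr - p" for n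
      using bd[of "Complex c t" for t] that
      by (auto simp: indicator_def intro: order_trans[OF norm_ge_zero])
  qed
  have horiz: "cmod (G (Complex b y) - G (Complex a y)) \<le> B * (1 + \<bar>y\<bar>) powr - p * (b - a)" for y
  proof -
    have "cmod (G (Complex b y) - G (Complex a y)) \<le> (B * (1 + \<bar>y\<bar>) powr - p) * cmod (Complex b y - Complex a y)"
    proof (rule field_differentiable_bound[where S = "closed_segment (Complex a y) (Complex b y)" and f' = F])
      fix z assume "z \<in> closed_segment (Complex a y) (Complex b y)"
      then have z: "Im z = y" "a \<le> Re z" "Re z \<le> b"
      proof -
        from \<open>z \<in> _\<close> obtain u where u: "0 \<le> u" "u \<le> 1" "z = (1 - u) *\<^sub>R Complex a y + u *\<^sub>R Complex b y"
          by (auto simp: in_segment)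
        show "Im z = y" unfolding u(3) by (simp add: algebra_simps)
        have "Re z = a + u * (b - a)" unfolding u(3) by (simp add: algebra_simps)
        moreover have "0 \<le> u * (b - a)" "u * (b - a) \<le> 1 * (b - a)"
          using u ab by (simp, intro mult_right_mono) auto
        ultimately show "a \<le> Re z" "Re z \<le> b" by auto
      qed
      show "cmod (F z) \<le> B * (1 + \<bar>y\<bar>) powr - p" using bd[of z] z by auto
      show "(G has_field_derivative F z) (at z within closed_segment (Complex a y) (Complex b y))"
        using G[of z] z ab by (auto intro: has_field_derivative_at_within)
    qed auto
    moreover have "cmod (Complex b y - Complex a y) = b - a"
      using ab by (simp add: cmod_def)
    ultimately show ?thesis by simp
  qed
  have "(\<lambda>n. (LINT t|lborel. indicator {- real n..real n} t *\<^sub>R F (Complex b t))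
      - (LINT t|lborel. indicator {- real n..real n} t *\<^sub>R F (Complex a t))) \<longlonglongrightarrow> 0"
  proof (rule Lim_null_comparison)
    show "\<forall>\<^sub>F n in sequentially. norm ((LINT t|lborel. indicator {- real n..real n} t *\<^sub>R F (Complex b t))
      - (LINT t|lborel. indicator {- real n..real n} t *\<^sub>R F (Complex a t))) \<le> 2 * B * (b - a) * (1 + real n) powr - p"
    proof (rule always_eventually, rule allI)
      fix n
      let ?T = "real n"
      have "norm ((LINT t|lborel. indicator {- real n..real n} t *\<^sub>R F (Complex b t))
          - (LINT t|lborel. indicator {- real n..real n} t *\<^sub>R F (Complex a t)))
        = cmod (((G (Complex b ?T) - G (Complex a ?T)) - (G (Complex b (-?T)) - G (Complex a (-?T)))) / \<i>)"
        unfolding seg[of a ?T, OF ab(1) of_nat_0_le_iff] seg[of b ?T, OF less_le_trans[OF ab] of_nat_0_le_iff]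
          diff_divide_distrib by (simp only: algebra_simps)
      also have "\<dots> \<le> cmod (G (Complex b ?T) - G (Complex a ?T)) + cmod (G (Complex b (-?T)) - G (Complex a (-?T)))"
        by (simp add: norm_divide norm_mult norm_triangle_ineq4)
      also have "\<dots> \<le> 2 * B * (b - a) * (1 + real n) powr - p"
        using horiz[of ?T] horiz[of "-?T"] by (simp add: algebra_simps)
      finally show "norm ((LINT t|lborel. indicator {- real n..real n} t *\<^sub>R F (Complex b t))
      - (LINT t|lborel. indicator {- real n..real n} t *\<^sub>R F (Complex a t))) \<le> 2 * B * (b - a) * (1 + real n) powr - p" .
    qed
    have "(\<lambda>n. (1 + real n) powr - p) \<longlonglongrightarrow> 0"
      by (rule tendsto_neg_powr)
        (use p in \<open>auto intro!: filterlim_tendsto_add_at_top[OF tendsto_const filterlim_real_sequentially]\<close>)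
    from tendsto_mult[OF tendsto_const this, of "2 * B * (b - a)"]
    show "(\<lambda>n. 2 * B * (b - a) * (1 + real n) powr - p) \<longlonglongrightarrow> 0" by simp
  qed
  moreover have "(\<lambda>n. (LINT t|lborel. indicator {- real n..real n} t *\<^sub>R F (Complex b t))
      - (LINT t|lborel. indicator {- real n..real n} t *\<^sub>R F (Complex a t)))
      \<longlonglongrightarrow> (LINT t|lborel. F (Complex b t)) - (LINT t|lborel. F (Complex a t))"
    by (intro tendsto_diff lim) (use ab in auto)
  ultimately show ?thesis
    using LIMSEQ_unique by fastforce
qed

section \<open>The Perron integral: bounds, shift of the line, rescaling\<close>

definition perron_weight :: "real \<Rightarrow> real \<Rightarrow> complex \<Rightarrow> complex" where
  "perron_weight k x s = exp (of_real x * s) * s powr (- of_real (k + 1))"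

text \<open>The integration variable is the ordinate \<open>t\<close>, without the usual factor 1 /
  (2 pi i) and without the i of ds = i dt. The missing normalization is absorbed by
  \<open>perron_const\<close>.\<close>

definition perron :: "real \<Rightarrow> real \<Rightarrow> (complex \<Rightarrow> complex) \<Rightarrow> real \<Rightarrow> complex" where
  "perron c k f x = (LINT t|lborel. f (Complex c t) * perron_weight k x (Complex c t))"

lemma norm_powr_neg_real: "cmod (s powr (- of_real p)) = cmod s powr - p"
  using norm_powr_real_powr'[of "- of_real p" s] by simp

lemma norm_perron_weight:
  "cmod (perron_weight k x s) = exp (x * Re s) * cmod s powr - (k + 1)"
  unfolding perron_weight_def norm_mult norm_powr_neg_real by simp

lemma holomorphic_perron_weight: "perron_weight k x holomorphic_on right_half_plane 0"
  unfolding perron_weight_def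
  by (intro holomorphic_intros) (auto simp: complex_nonpos_Reals_iff)

lemma continuous_perron_weight: "continuous_on (right_half_plane 0) (perron_weight k x)"
  using holomorphic_perron_weight by (rule holomorphic_on_imp_continuous_on)

text \<open>Differentiating the weight in \<open>x\<close> multiplies it by \<open>s\<close>. So a
  derivative in \<open>x\<close> turns order \<open>k + 1\<close> into order \<open>k\<close>, which
  is the mechanism of the descent.\<close>

lemma perron_weight_mult: "Re s > 0 \<Longrightarrow> s * perron_weight (k + 1) x s = perron_weight k x s"
proof -
  assume "Re s > 0"
  then have s: "s \<noteq> 0" by auto
  have "s powr (- of_real (k + 1)) = s powr (1 + - of_real (k + 1 + 1))"
    by (simp add: algebra_simps)
  also have "\<dots> = s * s powr (- of_real (k + 1 + 1))"
    using s by (subst powr_add) simp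
  finally show ?thesis unfolding perron_weight_def by (simp only: ac_simps)
qed

text \<open>Growth of exponent \<open>q\<close> uses up \<open>q\<close> of the \<open>k + 1\<close>
  powers of decay. The remaining exponent exceeds 1 exactly when \<open>q < k\<close>; this is where
  the condition \<open>l < k\<close> of the theorem comes from.\<close>

lemma perron_integrand_bound:
  assumes "0 < c" "c \<le> Re s" "0 \<le> k" "cmod (f s) \<le> B * (1 + \<bar>Im s\<bar>) powr q"
  shows "cmod (f s * perron_weight k x s)
    \<le> B * exp (x * Re s) * (min 1 c / 2) powr - (k + 1) * (1 + \<bar>Im s\<bar>) powr - (k + 1 - q)"
proof -
  have "cmod (f s * perron_weight k x s)
    \<le> (B * (1 + \<bar>Im s\<bar>) powr q) * (exp (x * Re s) * ((min 1 c / 2) powr - (k + 1) * (1 + \<bar>Im s\<bar>) powr - (k + 1)))"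
    unfolding norm_mult norm_perron_weight
    using assms cmod_powr_le[OF assms(1,2), of "k + 1"]
    by (intro mult_mono mult_left_mono) (auto intro: order_trans[OF norm_ge_zero])
  also have "\<dots> = B * exp (x * Re s) * (min 1 c / 2) powr - (k + 1) * ((1 + \<bar>Im s\<bar>) powr q * (1 + \<bar>Im s\<bar>) powr - (k + 1))"
    by (simp only: ac_simps)
  also have "(1 + \<bar>Im s\<bar>) powr q * (1 + \<bar>Im s\<bar>) powr - (k + 1) = (1 + \<bar>Im s\<bar>) powr - (k + 1 - q)"
    by (simp add: algebra_simps flip: powr_add)
  finally show ?thesis .
qed

lemma perron_integrable:
  assumes "continuous_on (right_half_plane 0) f" "0 < c" "0 \<le> k" "q < k"
    and "\<And>t. cmod (f (Complex c t)) \<le> B * (1 + \<bar>t\<bar>) powr q"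
  shows "integrable lborel (\<lambda>t. f (Complex c t) * perron_weight k x (Complex c t))"
proof (rule integrable_vline[where F = "\<lambda>s. f s * perron_weight k x s" and p = "k + 1 - q"
      and B = "B * exp (x * c) * (min 1 c / 2) powr - (k + 1)"])
  show "continuous_on (right_half_plane 0) (\<lambda>s. f s * perron_weight k x s)"
    by (intro continuous_on_mult assms continuous_perron_weight)
  show "cmod (f (Complex c t) * perron_weight k x (Complex c t))
    \<le> B * exp (x * c) * (min 1 c / 2) powr - (k + 1) * (1 + \<bar>t\<bar>) powr - (k + 1 - q)" for t
    using perron_integrand_bound[of c "Complex c t" k f B q x] assms by simp
qed (use assms in auto)

lemma perron_shift:
  assumes "f holomorphic_on right_half_plane 0" "0 < a" "a \<le> b" "0 \<le> k" "q < k"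
    and bd: "\<And>s. a \<le> Re s \<Longrightarrow> Re s \<le> b \<Longrightarrow> cmod (f s) \<le> B * (1 + \<bar>Im s\<bar>) powr q"
  shows "perron a k f x = perron b k f x"
  unfolding perron_def
proof (rule vline_integral_shift[where F = "\<lambda>s. f s * perron_weight k x s" and p = "k + 1 - q"
      and B = "B * exp (\<bar>x\<bar> * b) * (min 1 a / 2) powr - (k + 1)"])
  show "(\<lambda>s. f s * perron_weight k x s) holomorphic_on right_half_plane 0"
    by (intro holomorphic_on_mult assms holomorphic_perron_weight)
  fix s assume s: "a \<le> Re s" "Re s \<le> b"
  have "0 \<le> B * (1 + \<bar>Im s\<bar>) powr q"
    using bd[OF s] norm_ge_zero order_trans by blast
  then have B: "B \<ge> 0"
    using abs_ge_zero[of "Im s"] by (auto simp: zero_le_mult_iff)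
  \<comment> \<open>\<open>x\<close> may be negative, so the exponential is bounded on the strip by
    means of the absolute value of \<open>x\<close>.\<close>
  have "x * Re s \<le> \<bar>x\<bar> * b"
    using s assms by (intro mult_mono) auto
  then have *: "B * exp (x * Re s) * (min 1 a / 2) powr - (k + 1) * (1 + \<bar>Im s\<bar>) powr - (k + 1 - q)
     \<le> B * exp (\<bar>x\<bar> * b) * (min 1 a / 2) powr - (k + 1) * (1 + \<bar>Im s\<bar>) powr - (k + 1 - q)"
    using B by (intro mult_right_mono mult_left_mono) auto
  show "cmod (f s * perron_weight k x s)
    \<le> B * exp (\<bar>x\<bar> * b) * (min 1 a / 2) powr - (k + 1) * (1 + \<bar>Im s\<bar>) powr - (k + 1 - q)"
    by (rule order_trans[OF perron_integrand_bound *]) (use assms s bd in auto)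
qed (use assms in auto)

lemma perron_weight_scale:
  assumes "r > 0"
  shows "perron_weight k x (of_real r * s) = of_real (r powr - (k + 1)) * perron_weight k (r * x) s"
proof -
  have "(of_real r * s) powr (- of_real (k + 1)) = of_real (r powr - (k + 1)) * s powr (- of_real (k + 1))"
    using assms powr_of_real[of r "- (k + 1)"] by (subst powr_times_real_left) auto
  then show ?thesis
    unfolding perron_weight_def by (simp add: ac_simps)
qed

text \<open>Homogeneity: the power of \<open>s\<close> contributes \<open>r powr - (k + 1)\<close>
  and the Jacobian one factor \<open>r\<close>. With \<open>r = 1 / x\<close> the line of abscissa
  \<open>1 / x\<close> becomes the line of abscissa 1, and the exponential no longer depends on
  \<open>x\<close>.\<close>

lemma perron_scale:
  assumes "r > 0"
  shows "perron (r * c) k f x = of_real (r powr - k) * perron c k (\<lambda>s. f (of_real r * s)) (r * x)"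
proof -
  have C: "Complex (r * c) (0 + r * t) = of_real r * Complex c t" for t
    by (simp add: complex_eq_iff)
  have e: "r powr - k = r * r powr - (k + 1)"
    using assms powr_add[of r 1 "- (k + 1)"] by simp
  have "perron (r * c) k f x
      = r *\<^sub>R (LINT t|lborel. f (of_real r * Complex c t) * (of_real (r powr - (k + 1)) * perron_weight k (r * x) (Complex c t)))"
    unfolding perron_def using assms
    by (subst lborel_integral_real_affine[of r _ 0]) (simp_all only: C perron_weight_scale, auto)
  also have "\<dots> = r *\<^sub>R (of_real (r powr - (k + 1)) * perron c k (\<lambda>s. f (of_real r * s)) (r * x))"
    unfolding perron_def integral_mult_right_zero[symmetric] by (simp only: ac_simps)
  finally show ?thesis unfolding e by (simp add: scaleR_conv_of_real)
qed

section \<open>The Perron integral of the constant 1\<close>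

text \<open>Classically 2 pi / Gamma(k + 1). Only its nonvanishing and its ratio between the orders
  \<open>k\<close> and \<open>k + 1\<close> are used.\<close>

definition perron_const :: "real \<Rightarrow> complex" where
  "perron_const k = perron 1 k (\<lambda>_. 1) 1"

lemma perron_one_integrable:
  assumes "0 < c" "0 < k"
  shows "integrable lborel (\<lambda>t. perron_weight k x (Complex c t))"
  using perron_integrable[of "\<lambda>_. 1" c k 0 1 x] assms by simp

lemma perron_one_shift: 
  assumes "0 < a" "0 < b" "0 < k"
  shows "perron a k (\<lambda>_. 1) x = perron b k (\<lambda>_. 1) x"
proof (cases "a \<le> b")
  case True
  show ?thesis
    by (rule perron_shift[where q = 0 and B = 1]) (use assms True in auto)
next
  case False
  show ?thesis
    by (rule sym, rule perron_shift[where q = 0 and B = 1]) (use assms False in auto)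
qed

lemma norm_perron_one_le:
  assumes "0 < k"
  shows "cmod (perron 1 k (\<lambda>_. 1) x) \<le> exp x * (LINT t|lborel. cmod (Complex 1 t) powr - (k + 1))"
proof -
  have "cmod (perron 1 k (\<lambda>_. 1) x) \<le> (LINT t|lborel. cmod (perron_weight k x (Complex 1 t)))"
    unfolding perron_def by (simp add: integral_norm_bound)
  then show ?thesis
    unfolding norm_perron_weight by simp
qed

text \<open>For \<open>x \<le> 0\<close> the line of integration is moved to infinity; for \<open>x > 0\<close> it is moved to
  abscissa \<open>1 / x\<close> and rescaled.\<close>

lemma perron_one:
  assumes "0 < c" "0 < k"
  shows "perron c k (\<lambda>_. 1) x = (if 0 < x then of_real (x powr k) * perron_const k else 0)"
proof (cases "0 < x")
  case True
  have "perron c k (\<lambda>_. 1) x = perron (1 / x * 1) k (\<lambda>_. 1) x"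
    using assms True by (intro perron_one_shift) auto
  also have "\<dots> = of_real ((1 / x) powr - k) * perron 1 k (\<lambda>_. 1) (1 / x * x)"
    using True by (intro perron_scale) auto
  also have "(1 / x) powr - k = x powr k"
    using True by (simp add: powr_divide powr_minus_divide)
  finally show ?thesis using True unfolding perron_const_def by simp
next
  case False
  define J where "J = (LINT t|lborel. cmod (Complex 1 t) powr - (k + 1))"
  have J: "J \<ge> 0" unfolding J_def by (rule Bochner_Integration.integral_nonneg) simp
  \<comment> \<open>As \<open>x \<le> 0\<close>, the exponential is at most 1 and all decay comes
    from \<open>r powr - k\<close>; hence \<open>x = 0\<close> is covered as well.\<close>
  have le: "cmod (perron c k (\<lambda>_. 1) x) \<le> r powr - k * J" if "r > 0" for r
  proof -
    have "perron c k (\<lambda>_. 1) x = perron (r * 1) k (\<lambda>_. 1) x"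
      using assms that by (intro perron_one_shift) auto
    also have "\<dots> = of_real (r powr - k) * perron 1 k (\<lambda>_. 1) (r * x)"
      using that by (intro perron_scale) auto
    finally have "cmod (perron c k (\<lambda>_. 1) x) = r powr - k * cmod (perron 1 k (\<lambda>_. 1) (r * x))"
      by (simp add: norm_mult)
    also have "cmod (perron 1 k (\<lambda>_. 1) (r * x)) \<le> exp (r * x) * J"
      unfolding J_def using assms by (intro norm_perron_one_le)
    also have "\<dots> \<le> 1 * J"
      using that False J by (intro mult_right_mono) (auto simp: mult_le_0_iff)
    finally show ?thesis by (simp add: mult_left_mono)
  qed
  have "((\<lambda>r. r powr - k * J) \<longlongrightarrow> 0 * J) at_top"
    by (intro tendsto_mult tendsto_const tendsto_neg_powr filterlim_ident) (use assms in auto)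
  then have "((\<lambda>r. r powr - k * J) \<longlongrightarrow> 0) at_top" by simp
  then have "cmod (perron c k (\<lambda>_. 1) x) \<le> 0"
    by (rule tendsto_lowerbound) (auto intro!: eventually_mono[OF eventually_gt_at_top[of 0]] le)
  then show ?thesis using False by simp
qed

section \<open>Differentiation of the Perron integral, and nonvanishing of the constant\<close>

text \<open>Mean value estimate along the segment from 0 to \<open>z\<close>, where real parts stay
  below \<open>Re z\<close>. It provides the dominating function for the difference quotients that
  follow.\<close>

lemma norm_exp_minus_one_le:
  assumes "0 \<le> Re z"
  shows "cmod (exp z - 1) \<le> exp (Re z) * cmod z"
proof -
  have "cmod (exp z - exp 0) \<le> exp (Re z) * cmod (z - 0)"
  proof (rule field_differentiable_bound[where S = "closed_segment 0 z" and f' = exp])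
    fix y assume "y \<in> closed_segment 0 z"
    then obtain u where "0 \<le> u" "u \<le> 1" "y = u *\<^sub>R z" by (auto simp: in_segment)
    then show "cmod (exp y) \<le> exp (Re z)"
      using assms by (auto intro: mult_left_le_one_le)
  qed (auto intro!: derivative_eq_intros)
  then show ?thesis by simp
qed

text \<open>Differentiation under the integral sign. A limit along the positive steps
  \<open>1 / Suc n\<close> is enough, because both sides of the Perron formula are differentiated
  along the same sequence. The condition \<open>q < k\<close> makes the order \<open>k\<close>
  integrand itself integrable, and a multiple of it dominates.\<close>

lemma perron_difference_quotient:
  assumes f: "continuous_on (right_half_plane 0) f" and c: "0 < c" and k: "0 \<le> k" "q < k"
    and bd: "\<And>t. cmod (f (Complex c t)) \<le> B * (1 + \<bar>t\<bar>) powr q"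
  shows "(\<lambda>n. (perron c (k + 1) f (x + 1 / Suc n) - perron c (k + 1) f x) * of_nat (Suc n)) \<longlonglongrightarrow> perron c k f x"
proof -
  \<comment> \<open>With h = 1 / Suc n this is (exp(hs) - 1) / (hs), the ratio of the difference
    quotient of the order \<open>k + 1\<close> integrand to the order \<open>k\<close> integrand. It
    tends to 1 and, as h is at most 1, is bounded by \<open>exp c\<close> on the line.\<close>
  define E where "E n s = (exp (of_real (1 / Suc n) * s) - 1) / (of_real (1 / Suc n) * s)" for n :: nat and s :: complex
  have "(perron c (k + 1) f (x + 1 / Suc n) - perron c (k + 1) f x) * of_nat (Suc n)
     = (LINT t|lborel. E n (Complex c t) * (f (Complex c t) * perron_weight k x (Complex c t)))" for n
  proof -
    have int: "integrable lborel (\<lambda>t. f (Complex c t) * perron_weight (k + 1) y (Complex c t))" for y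
      using assms by (intro perron_integrable[where q = q and B = B]) auto
    have "E n s * (f s * perron_weight k x s)
      = (f s * perron_weight (k + 1) (x + 1 / Suc n) s - f s * perron_weight (k + 1) x s) * of_nat (Suc n)"
      if "Re s > 0" for s
    proof -
      have "s \<noteq> 0" using that by auto
      have "perron_weight (k + 1) (x + 1 / Suc n) s = exp (of_real (1 / Suc n) * s) * perron_weight (k + 1) x s"
        unfolding perron_weight_def by (simp add: distrib_right exp_add del: of_nat_Suc)
      moreover have "E n s * s = (exp (of_real (1 / Suc n) * s) - 1) * of_nat (Suc n)"
        unfolding E_def using \<open>s \<noteq> 0\<close> by (simp add: field_simps del: of_nat_Suc)
      moreover have "e * (v * (s * w)) = (v * (X * w) - v * w) * N"
        if "e * s = (X - 1) * N" for e v w X N :: complex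
      proof -
        have "e * (v * (s * w)) = (e * s) * (v * w)" by (simp only: ac_simps)
        then show ?thesis unfolding that by (simp add: algebra_simps)
      qed
      ultimately show ?thesis
        unfolding perron_weight_mult[OF that, of k x, symmetric] by simp
    qed
    then have "(LINT t|lborel. E n (Complex c t) * (f (Complex c t) * perron_weight k x (Complex c t)))
      = (LINT t|lborel. (f (Complex c t) * perron_weight (k + 1) (x + 1 / Suc n) (Complex c t)
         - f (Complex c t) * perron_weight (k + 1) x (Complex c t)) * of_nat (Suc n))"
      using c by (intro Bochner_Integration.integral_cong) auto
    also have "\<dots> = (perron c (k + 1) f (x + 1 / Suc n) - perron c (k + 1) f x) * of_nat (Suc n)"
      unfolding perron_def integral_mult_left_zero by (subst Bochner_Integration.integral_diff[OF int int]) simp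
    finally show ?thesis by simp
  qed
  moreover have "(\<lambda>n. LINT t|lborel. E n (Complex c t) * (f (Complex c t) * perron_weight k x (Complex c t)))
    \<longlonglongrightarrow> perron c k f x"
    unfolding perron_def
  proof (rule integral_dominated_convergence)
    have int: "integrable lborel (\<lambda>t. f (Complex c t) * perron_weight k x (Complex c t))"
      using assms by (intro perron_integrable[where q = q and B = B]) auto
    then show "integrable lborel (\<lambda>t. exp c * cmod (f (Complex c t) * perron_weight k x (Complex c t)))"
      by (intro integrable_mult_right integrable_norm)
    show m: "(\<lambda>t. f (Complex c t) * perron_weight k x (Complex c t)) \<in> borel_measurable lborel"
      using int by simp
    have "(\<lambda>t. E n (Complex c t)) \<in> borel_measurable borel" for n
      unfolding E_def
      by (intro measurable_vline[where F = "\<lambda>s. (exp (of_real (1 / Suc n) * s) - 1) / (of_real (1 / Suc n) * s)"]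
          continuous_intros) (use c in \<open>auto simp del: of_nat_Suc\<close>)
    then show "(\<lambda>t. E n (Complex c t) * (f (Complex c t) * perron_weight k x (Complex c t))) \<in> borel_measurable lborel" for n
      using m by (auto intro!: borel_measurable_times)
    show "AE t in lborel. (\<lambda>n. E n (Complex c t) * (f (Complex c t) * perron_weight k x (Complex c t)))
        \<longlonglongrightarrow> f (Complex c t) * perron_weight k x (Complex c t)"
    proof (rule AE_I2)
      fix t
      let ?s = "Complex c t"
      have s: "?s \<noteq> 0" using c by (auto simp: complex_eq_iff)
      have "((\<lambda>z. (exp (0 + z) - exp 0) / z) \<longlongrightarrow> exp 0) (at (0::complex))"
        using DERIV_exp[of "0::complex"] unfolding DERIV_def .
      then have lim: "((\<lambda>z. (exp z - 1) / z) \<longlongrightarrow> 1) (at (0::complex))" by simp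
      have "(\<lambda>n. of_real (1 / Suc n) * ?s) \<longlonglongrightarrow> of_real 0 * ?s"
        by (intro tendsto_intros LIMSEQ_Suc lim_1_over_n)
      then have "filterlim (\<lambda>n. of_real (1 / Suc n) * ?s) (at 0) sequentially"
        unfolding filterlim_at using s by (auto intro!: always_eventually simp del: of_nat_Suc)
      from filterlim_compose[OF lim this] have "(\<lambda>n. E n ?s) \<longlonglongrightarrow> 1"
        unfolding E_def .
      from tendsto_mult[OF this tendsto_const]
      show "(\<lambda>n. E n ?s * (f ?s * perron_weight k x ?s)) \<longlonglongrightarrow> f ?s * perron_weight k x ?s"
        by simp
    qed
    show "AE t in lborel. norm (E n (Complex c t) * (f (Complex c t) * perron_weight k x (Complex c t)))
        \<le> exp c * cmod (f (Complex c t) * perron_weight k x (Complex c t))" for n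
    proof (rule AE_I2)
      fix t
      let ?z = "of_real (1 / Suc n) * Complex c t"
      have z: "?z \<noteq> 0" using c by (auto simp: complex_eq_iff simp del: of_nat_Suc)
      have Re: "Re ?z = 1 / Suc n * c" by simp
      have "1 / Suc n * c \<le> 1 * c"
        using c by (intro mult_right_mono) auto
      then have "cmod (E n (Complex c t)) \<le> exp c"
        using norm_exp_minus_one_le[of ?z] z c Re unfolding E_def norm_divide
        by (subst pos_divide_le_eq) (auto intro: order_trans mult_right_mono simp del: of_nat_Suc)
      then show "norm (E n (Complex c t) * (f (Complex c t) * perron_weight k x (Complex c t)))
        \<le> exp c * cmod (f (Complex c t) * perron_weight k x (Complex c t))"
        by (simp add: norm_mult mult_right_mono)
    qed
  qed
  ultimately show ?thesis by simp
qed

text \<open>If the constant vanished, so would the Fourier transform of \<open>t \<mapsto> (1 + it)\<^bsup>-k-1\<^esup>\<close>; averaging it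
  against a Gaussian measure and concentrating the resulting weight at \<open>t = 0\<close> gives a contradiction.\<close>

lemma perron_const_nonzero:
  assumes "0 < k"
  shows "perron_const k \<noteq> 0"
proof
  assume zero: "perron_const k = 0"
  define g where "g t = Complex 1 t powr (- of_real (k + 1))" for t
  have "continuous_on (right_half_plane 0) (\<lambda>s. s powr (- of_real (k + 1)))"
    by (intro continuous_intros) (auto simp: complex_nonpos_Reals_iff)
  then have cg: "continuous_on UNIV g"
    unfolding g_def by (rule continuous_vline) simp
  then have g_meas [measurable]: "g \<in> borel_measurable borel"
    by (rule borel_measurable_continuous_onI)
  have w: "perron_weight k u (Complex 1 t) = of_real (exp u) * (g t * iexp (t * u))" for u t
  proof -
    have "of_real u * Complex 1 t = of_real u + \<i> * of_real (t * u)"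
      by (simp add: complex_eq_iff)
    then show ?thesis
      unfolding perron_weight_def g_def by (simp add: exp_add ac_simps flip: exp_of_real)
  qed
  have gi: "integrable lborel g"
    using perron_one_integrable[of 1 k 0] assms unfolding w by simp
  \<comment> \<open>For \<open>u > 0\<close> the vanishing is the assumption on the constant; for
    \<open>u \<le> 0\<close> it is the case where the line is moved to infinity.\<close>
  have g0: "(LINT t|lborel. g t * iexp (t * u)) = 0" for u
  proof -
    have "of_real (exp u) * (LINT t|lborel. g t * iexp (t * u)) = perron 1 k (\<lambda>_. 1) u"
      unfolding perron_def w by simp
    then show ?thesis
      using perron_one[of 1 k u] assms zero by (simp split: if_splits)
  qed
  interpret N: prob_space std_normal_distribution
    by (rule prob_space_normal_density) simp
  interpret NL: pair_sigma_finite std_normal_distribution lborel ..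
  have sets_N [measurable_cong]: "sets std_normal_distribution = sets borel"
    by simp
  \<comment> \<open>Averaging over \<open>u\<close> with the standard normal law, at frequency
    \<open>?n * u\<close>, replaces \<open>iexp\<close> by the normal characteristic function;
    Fubini applies as \<open>g\<close> is integrable. The substitution t = v / n then gives the
    stated form.\<close>
  have gauss0: "(LINT v|lborel. g (v / Suc n) * of_real (exp (- v\<^sup>2 / 2))) = 0" for n
  proof -
    let ?n = "real (Suc n)"
    have int: "integrable (std_normal_distribution \<Otimes>\<^sub>M lborel) (\<lambda>(u, t). g t * iexp (t * (?n * u)))"
    proof (rule NL.Fubini_integrable)
      show "(\<lambda>(u, t). g t * iexp (t * (?n * u))) \<in> borel_measurable (std_normal_distribution \<Otimes>\<^sub>M lborel)"
        by measurable
      show "AE u in std_normal_distribution. integrable lborel (\<lambda>t. case (u, t) of (u, t) \<Rightarrow> g t * iexp (t * (?n * u)))"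
        by (intro AE_I2) (auto intro!: Bochner_Integration.integrable_bound[OF gi] simp: norm_mult)
      show "integrable std_normal_distribution
          (\<lambda>u. LINT t|lborel. norm (case (u, t) of (u, t) \<Rightarrow> g t * iexp (t * (?n * u))))"
        by (simp add: norm_mult)
    qed
    have "0 = (LINT u|std_normal_distribution. LINT t|lborel. g t * iexp (t * (?n * u)))"
      by (simp only: g0 Bochner_Integration.integral_zero)
    also have "\<dots> = (LINT t|lborel. LINT u|std_normal_distribution. g t * iexp (t * (?n * u)))"
      using NL.Fubini_integral[OF int] by simp
    also have "\<dots> = (LINT t|lborel. g t * of_real (exp (- (?n * t)\<^sup>2 / 2)))"
    proof (rule Bochner_Integration.integral_cong)
      fix t
      have "(LINT u|std_normal_distribution. g t * iexp (t * (?n * u)))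
        = g t * char std_normal_distribution (?n * t)"
        unfolding char_def integral_mult_right_zero[symmetric] by (simp only: ac_simps)
      then show "(LINT u|std_normal_distribution. g t * iexp (t * (?n * u)))
        = g t * of_real (exp (- (?n * t)\<^sup>2 / 2))"
        unfolding char_std_normal_distribution .
    qed simp
    also have "\<dots> = (1 / ?n) *\<^sub>R (LINT v|lborel. g (v / Suc n) * of_real (exp (- v\<^sup>2 / 2)))"
      by (subst lborel_integral_real_affine[of "1 / ?n" _ 0]) (simp_all del: of_nat_Suc)
    finally show ?thesis by simp
  qed
  \<comment> \<open>The factor \<open>g (v / Suc n)\<close> tends to \<open>g 0 = 1\<close>, so the
    vanishing integrals converge to the Gaussian integral, which is positive.\<close>
  have "(\<lambda>n. LINT v|lborel. g (v / Suc n) * of_real (exp (- v\<^sup>2 / 2)))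
    \<longlonglongrightarrow> (LINT v|lborel. of_real (exp (- v\<^sup>2 / 2)))"
  proof (rule integral_dominated_convergence)
    show "integrable lborel (\<lambda>v::real. exp (- v\<^sup>2 / 2))"
      using integrable_mult_right[OF integrable_normal_density[of 1 0], of "sqrt (2 * pi)"]
      by (simp add: std_normal_density_def)
    show "AE v in lborel. (\<lambda>n. g (v / Suc n) * of_real (exp (- v\<^sup>2 / 2))) \<longlonglongrightarrow> of_real (exp (- v\<^sup>2 / 2))"
    proof (rule AE_I2)
      fix v :: real
      have "(\<lambda>n. v * (1 / Suc n)) \<longlonglongrightarrow> v * 0"
        by (intro tendsto_intros LIMSEQ_Suc lim_1_over_n)
      then have "(\<lambda>n. v / Suc n) \<longlonglongrightarrow> 0" by simp
      then have "(\<lambda>n. g (v / Suc n)) \<longlonglongrightarrow> g 0"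
        using cg by (intro isCont_tendsto_compose[of 0 g]) (auto simp: continuous_on_eq_continuous_at)
      moreover have "Complex 1 0 = 1" by (simp add: complex_eq_iff)
      then have "g 0 = 1" unfolding g_def by simp
      ultimately have "(\<lambda>n. g (v / Suc n)) \<longlonglongrightarrow> 1" by simp
      from tendsto_mult[OF this tendsto_const]
      show "(\<lambda>n. g (v / Suc n) * of_real (exp (- v\<^sup>2 / 2))) \<longlonglongrightarrow> of_real (exp (- v\<^sup>2 / 2))" by simp
    qed
    have "cmod (g t) \<le> 1" for t
    proof -
      have "1 \<le> cmod (Complex 1 t)" by (simp add: cmod_def)
      then have "cmod (Complex 1 t) powr - (k + 1) \<le> 1 powr - (k + 1)"
        using assms by (intro powr_mono2') auto
      then show ?thesis unfolding g_def norm_powr_neg_real by simp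
    qed
    then show "AE v in lborel. norm (g (v / Suc n) * of_real (exp (- v\<^sup>2 / 2))) \<le> exp (- v\<^sup>2 / 2)" for n
      by (auto simp: norm_mult intro!: mult_left_le_one_le)
  qed auto
  then have "(LINT v|lborel. complex_of_real (exp (- v\<^sup>2 / 2))) = 0"
    unfolding gauss0 using LIMSEQ_unique tendsto_const by metis
  then have "(LINT v|lborel. exp (- v\<^sup>2 / 2)) = (0::real)"
    by (simp only: integral_complex_of_real of_real_eq_0_iff)
  then have "(LINT v|lborel. std_normal_density v) = 0"
    unfolding std_normal_density_def by simp
  then show False
    using integral_normal_density[of 1 0] by simp
qed

section \<open>Riesz means: boundedness and raising the order\<close>

lemma frequency_finite:
  assumes "frequency lam"
  shows "finite {n. lam n < x}"
proof -
  have "\<forall>\<^sub>F n in sequentially. x \<le> lam n"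
    using assms unfolding frequency_def filterlim_at_top by blast
  then obtain N where "\<And>n. n \<ge> N \<Longrightarrow> x \<le> lam n"
    unfolding eventually_sequentially by blast
  then have "{n. lam n < x} \<subseteq> {..<N}"
    by (auto simp: not_le[symmetric])
  then show ?thesis by (rule finite_subset) simp
qed

lemma frequency_nonneg: "frequency lam \<Longrightarrow> 0 \<le> lam n"
  unfolding frequency_def by blast

lemma riesz_weight_le_one:
  assumes "(0::real) \<le> v" "v < x" "0 \<le> m"
  shows "(1 - v / x) powr m \<le> 1"
  using assms by (intro powr_le1) auto

text \<open>Convergence controls the means only from some \<open>Y\<close> on. Below
  \<open>Y\<close> all weights are at most 1, which leaves the absolute values of a fixed finite
  sum.\<close>

lemma riesz_mean_bounded:
  assumes lam: "frequency lam" and m: "0 \<le> m"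
    and lim: "((\<lambda>x. riesz_mean lam m a x s) \<longlongrightarrow> L) at_top"
  obtains M where "\<And>x. 0 < x \<Longrightarrow> cmod (riesz_mean lam m a x s) \<le> M"
proof -
  have "\<forall>\<^sub>F x in at_top. cmod (riesz_mean lam m a x s) < cmod L + 1"
    by (rule order_tendstoD[OF tendsto_norm[OF lim]]) simp
  then obtain Y where Y: "\<And>x. Y \<le> x \<Longrightarrow> cmod (riesz_mean lam m a x s) \<le> cmod L + 1"
    unfolding eventually_at_top_linorder by (meson less_imp_le)
  define M where "M = (\<Sum>n | lam n < Y. cmod (a n * exp (- of_real (lam n) * s)))"
  have "cmod (riesz_mean lam m a x s) \<le> M" if "0 < x" "x < Y" for x
  proof -
    have "cmod (riesz_mean lam m a x s)
        \<le> (\<Sum>n | lam n < x. cmod (a n * exp (- of_real (lam n) * s)))"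
      unfolding riesz_mean_def
    proof (rule sum_norm_le)
      fix n assume "n \<in> {n. lam n < x}"
      then have "(1 - lam n / x) powr m \<le> 1"
        using frequency_nonneg[OF lam] m by (intro riesz_weight_le_one) auto
      then show "cmod (a n * exp (- of_real (lam n) * s) * of_real ((1 - lam n / x) powr m))
        \<le> cmod (a n * exp (- of_real (lam n) * s))"
        by (simp add: norm_mult mult_left_le)
    qed
    also have "\<dots> \<le> M"
      unfolding M_def using that frequency_finite[OF lam] by (intro sum_mono2) auto
    finally show ?thesis .
  qed
  then have "cmod (riesz_mean lam m a x s) \<le> max M (cmod L + 1)" if "0 < x" for x
    using that Y[of x] by (cases "x < Y") (auto intro: max.coboundedI1 max.coboundedI2)
  then show thesis by (rule that)
qed

text \<open>Riesz means of order \<open>m + q + 1\<close> average those of order \<open>m\<close> against the Beta weight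
  \<open>u\<^sup>m (1 - u)\<^sup>q\<close> on the unit interval (first theorem of consistency).\<close>

definition beta_kernel :: "real \<Rightarrow> real \<Rightarrow> real \<Rightarrow> real \<Rightarrow> real" where
  "beta_kernel m q v u = indicator {v<..<1} u * ((u - v) powr m * (1 - u) powr q)"

lemma measurable_beta_kernel [measurable]: "beta_kernel m q v \<in> borel_measurable borel"
  unfolding beta_kernel_def by measurable

lemma integrable_beta_kernel:
  assumes "0 \<le> m" "0 \<le> q" "0 \<le> v"
  shows "integrable lborel (beta_kernel m q v)"
proof (rule Bochner_Integration.integrable_bound)
  show "integrable lborel (indicator {v<..<1} :: real \<Rightarrow> real)"
    using assms by (cases "v \<le> 1") (auto intro!: integrable_real_indicator)
  have "(u - v) powr m * (1 - u) powr q \<le> 1 powr m * 1 powr q" if "v < u" "u < 1" for u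
    using that assms by (intro mult_mono powr_mono2) auto
  then show "AE u in lborel. norm (beta_kernel m q v u) \<le> norm (indicator {v<..<1} u :: real)"
    by (auto simp: beta_kernel_def indicator_def)
qed simp

text \<open>The substitution u = v + (1 - v) z maps the unit interval onto the support. Homogeneity
  yields \<open>(1 - v) powr (m + q)\<close>, and the Jacobian the last factor. For
  \<open>v = lam n / x\<close> the result is the Riesz weight of order
  \<open>m + q + 1\<close>.\<close>

lemma integral_beta_kernel:
  assumes "0 \<le> v" "v < 1"
  shows "(LINT u|lborel. beta_kernel m q v u) = (1 - v) powr (m + q + 1) * (LINT u|lborel. beta_kernel m q 0 u)"
proof -
  have "(LINT u|lborel. beta_kernel m q v u) = (1 - v) * (LINT z|lborel. beta_kernel m q v (v + (1 - v) * z))"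
    using assms by (subst lborel_integral_real_affine[of "1 - v" _ v]) auto
  also have "(\<lambda>z. beta_kernel m q v (v + (1 - v) * z)) = (\<lambda>z. (1 - v) powr (m + q) * beta_kernel m q 0 z)"
  proof
    fix z
    have i: "indicator {v<..<1} (v + (1 - v) * z) = (indicator {0<..<1} z :: real)"
    proof -
      have "v + (1 - v) * z < 1 \<longleftrightarrow> 0 < (1 - v) * (1 - z)" by (auto simp: algebra_simps)
      also have "\<dots> \<longleftrightarrow> z < 1" using assms by (simp add: zero_less_mult_iff)
      finally show ?thesis using assms by (auto simp: indicator_def zero_less_mult_iff)
    qed
    have e: "1 - (v + (1 - v) * z) = (1 - v) * (1 - z)" by (simp add: algebra_simps)
    show "beta_kernel m q v (v + (1 - v) * z) = (1 - v) powr (m + q) * beta_kernel m q 0 z"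
      unfolding beta_kernel_def i e using assms by (simp add: powr_mult powr_add)
  qed
  finally show ?thesis
    using assms by (simp add: powr_add powr_one)
qed

text \<open>This is the Beta function at (m + 1, q + 1). To divide by it, positivity of the
  integrand on the open unit interval suffices.\<close>

lemma integral_beta_kernel_nonzero:
  assumes "0 \<le> m" "0 \<le> q"
  shows "(LINT u|lborel. beta_kernel m q 0 u) \<noteq> 0"
proof
  assume "(LINT u|lborel. beta_kernel m q 0 u) = 0"
  then have "AE u in lborel. beta_kernel m q 0 u = 0"
    using assms by (subst (asm) integral_nonneg_eq_0_iff_AE[OF integrable_beta_kernel])
      (auto simp: beta_kernel_def)
  then have "AE u in lborel. u \<notin> {0<..<1::real}"
    by (rule eventually_mono) (auto simp: beta_kernel_def)
  then have "emeasure lborel {0<..<1::real} = 0"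
    by (subst (asm) AE_iff_measurable[of "{0<..<1}"]) auto
  then show False by simp
qed

lemma riesz_mean_raise:
  assumes lam: "frequency lam" and m: "0 \<le> m" and q: "0 \<le> q"
    and lim: "((\<lambda>x. riesz_mean lam m a x s) \<longlongrightarrow> L) at_top"
  shows "((\<lambda>x. riesz_mean lam (m + q + 1) a x s) \<longlongrightarrow> L) at_top"
proof -
  define \<beta> where "\<beta> = (LINT u|lborel. beta_kernel m q 0 u)"
  \<comment> \<open>\<open>S x u\<close> is read in two ways. For fixed \<open>u\<close> it is the
    kernel at 0 times the order \<open>m\<close> mean at \<open>x * u\<close>, which gives the limit
    and the domination by \<open>M\<close>. Integrated over \<open>u\<close> term by term it is
    \<beta> times the mean of order \<open>m + q + 1\<close>.\<close>
  define S where "S x u = (\<Sum>n | lam n < x. a n * exp (- of_real (lam n) * s) * of_real (beta_kernel m q (lam n / x) u))" for x u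
  obtain M where M: "\<And>x. 0 < x \<Longrightarrow> cmod (riesz_mean lam m a x s) \<le> M"
    using riesz_mean_bounded[OF lam m lim] by blast
  have S_eq: "S x u = of_real (beta_kernel m q 0 u) * riesz_mean lam m a (x * u) s" if "0 < x" for x u
  proof (cases "0 < u \<and> u < 1")
    case True
    have "S x u = (\<Sum>n | lam n < x * u. a n * exp (- of_real (lam n) * s) * of_real (beta_kernel m q (lam n / x) u))"
      unfolding S_def
    proof (rule sum.mono_neutral_right[OF frequency_finite[OF lam]])
      show "{n. lam n < x * u} \<subseteq> {n. lam n < x}"
        using True that mult_left_le[of u x] by (auto intro: less_le_trans)
      show "\<forall>n\<in>{n. lam n < x} - {n. lam n < x * u}.
          a n * exp (- of_real (lam n) * s) * of_real (beta_kernel m q (lam n / x) u) = 0"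
        using that by (auto simp: beta_kernel_def field_simps)
    qed
    also have "\<dots> = (\<Sum>n | lam n < x * u. of_real (beta_kernel m q 0 u) *
        (a n * exp (- of_real (lam n) * s) * of_real ((1 - lam n / (x * u)) powr m)))"
    proof (rule sum.cong[OF refl])
      fix n assume n: "n \<in> {n. lam n < x * u}"
      have "u - lam n / x = u * (1 - lam n / (x * u))"
        using that True by (simp add: field_simps)
      then have "(u - lam n / x) powr m = u powr m * (1 - lam n / (x * u)) powr m"
        by (simp only: powr_mult)
      then have "beta_kernel m q (lam n / x) u = beta_kernel m q 0 u * (1 - lam n / (x * u)) powr m"
        using n that True by (auto simp: beta_kernel_def indicator_def field_simps)
      then show "a n * exp (- of_real (lam n) * s) * of_real (beta_kernel m q (lam n / x) u)
        = of_real (beta_kernel m q 0 u) * (a n * exp (- of_real (lam n) * s) * of_real ((1 - lam n / (x * u)) powr m))"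
        by simp
    qed
    finally show ?thesis unfolding riesz_mean_def sum_distrib_left .
  next
    case False
    then have "beta_kernel m q v u = 0" if "0 \<le> v" for v
      using that by (auto simp: beta_kernel_def indicator_def)
    then show ?thesis
      unfolding S_def using that frequency_nonneg[OF lam] by simp
  qed
  have limS: "((\<lambda>x. LINT u|lborel. S x u) \<longlongrightarrow> (LINT u|lborel. of_real (beta_kernel m q 0 u) * L)) at_top"
  proof (rule integral_dominated_convergence_at_top)
    show "integrable lborel (\<lambda>u. beta_kernel m q 0 u * M)"
      using integrable_beta_kernel[OF m q order_refl] by simp
    show "AE u in lborel. ((\<lambda>x. S x u) \<longlongrightarrow> of_real (beta_kernel m q 0 u) * L) at_top"
    proof (rule AE_I2)
      fix u :: real
      have "((\<lambda>x. of_real (beta_kernel m q 0 u) * riesz_mean lam m a (x * u) s)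
          \<longlongrightarrow> of_real (beta_kernel m q 0 u) * L) at_top"
      proof (cases "0 < u")
        case True
        then have "filterlim (\<lambda>x. x * u) at_top at_top"
          by (intro filterlim_at_top_mult_tendsto_pos[OF tendsto_const _ filterlim_ident])
        from filterlim_compose[OF lim this] show ?thesis
          by (intro tendsto_mult tendsto_const)
      qed (simp add: beta_kernel_def)
      moreover have "\<forall>\<^sub>F x in at_top. of_real (beta_kernel m q 0 u) * riesz_mean lam m a (x * u) s = S x u"
        using eventually_gt_at_top[of 0] by eventually_elim (simp add: S_eq)
      ultimately show "((\<lambda>x. S x u) \<longlongrightarrow> of_real (beta_kernel m q 0 u) * L) at_top"
        by (rule Lim_transform_eventually)
    qed
    show "\<forall>\<^sub>F x in at_top. AE u in lborel. norm (S x u) \<le> beta_kernel m q 0 u * M"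
      using eventually_gt_at_top[of 0]
    proof eventually_elim
      case (elim x)
      have "norm (S x u) \<le> beta_kernel m q 0 u * M" for u
      proof (cases "0 < u")
        case True
        then show ?thesis
          using M[of "x * u"] elim
          by (auto simp: S_eq norm_mult beta_kernel_def intro!: mult_left_mono)
      qed (simp add: S_eq elim beta_kernel_def)
      then show ?case by simp
    qed
  qed (simp_all add: S_def)
  have intL: "(LINT u|lborel. of_real (beta_kernel m q 0 u) * L) = of_real \<beta> * L"
    unfolding \<beta>_def by (simp add: integral_complex_of_real)
  have "(LINT u|lborel. S x u) = of_real \<beta> * riesz_mean lam (m + q + 1) a x s" if "0 < x" for x
  proof -
    have "(LINT u|lborel. S x u) = (\<Sum>n | lam n < x. a n * exp (- of_real (lam n) * s)
        * of_real (LINT u|lborel. beta_kernel m q (lam n / x) u))"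
      unfolding S_def using that frequency_nonneg[OF lam] m q
      by (subst Bochner_Integration.integral_sum)
        (auto intro!: integrable_mult_right integrable_beta_kernel simp: integral_complex_of_real)
    also have "\<dots> = of_real \<beta> * riesz_mean lam (m + q + 1) a x s"
      unfolding riesz_mean_def sum_distrib_left \<beta>_def
    proof (rule sum.cong[OF refl])
      fix n assume "n \<in> {n. lam n < x}"
      then have "(LINT u|lborel. beta_kernel m q (lam n / x) u)
          = (1 - lam n / x) powr (m + q + 1) * (LINT u|lborel. beta_kernel m q 0 u)"
        using that frequency_nonneg[OF lam] by (intro integral_beta_kernel) auto
      then show "a n * exp (- of_real (lam n) * s) * of_real (LINT u|lborel. beta_kernel m q (lam n / x) u)
        = of_real (LINT u|lborel. beta_kernel m q 0 u)
          * (a n * exp (- of_real (lam n) * s) * of_real ((1 - lam n / x) powr (m + q + 1)))"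
        by (simp add: ac_simps)
    qed
    finally show ?thesis .
  qed
  then have "\<forall>\<^sub>F x in at_top. (LINT u|lborel. S x u) = of_real \<beta> * riesz_mean lam (m + q + 1) a x s"
    by (intro eventually_mono[OF eventually_gt_at_top[of 0]]) auto
  from Lim_transform_eventually[OF limS this]
  have "((\<lambda>x. of_real \<beta> * riesz_mean lam (m + q + 1) a x s) \<longlongrightarrow> of_real \<beta> * L) at_top"
    unfolding intL .
  from tendsto_mult_left[OF this, of "inverse (of_real \<beta>)"] show ?thesis
    using integral_beta_kernel_nonzero[OF m q] unfolding \<beta>_def[symmetric]
    by (simp flip: mult.assoc)
qed

section \<open>Growth of Riesz means on vertical lines, by Taylor's formula\<close>

text \<open>The inequality t \<le> exp t at t = e y / N, raised to the power
  \<open>N\<close>.\<close>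

lemma power_le_exp:
  fixes y e :: real
  assumes "0 \<le> y" "0 < e"
  shows "y ^ N \<le> (real N / e) ^ N * exp (e * y)"
proof (cases "N = 0")
  case True
  then show ?thesis using assms by simp
next
  case False
  have "e * y / N \<le> exp (e * y / N)"
    using exp_ge_add_one_self[of "e * y / N"] by linarith
  then have "(e * y / N) ^ N \<le> exp (e * y / N) ^ N"
    using assms by (intro power_mono) auto
  also have "exp (e * y / N) ^ N = exp (e * y)"
    using False by (simp flip: exp_of_nat_mult)
  finally have "(real N / e) ^ N * (e * y / N) ^ N \<le> (real N / e) ^ N * exp (e * y)"
    using assms by (intro mult_left_mono) auto
  moreover have "real N / e * (e * y / N) = y"
    using False assms by simp
  ultimately show ?thesis
    by (simp only: power_mult_distrib[symmetric])
qed

lemma holomorphic_power_exp: "(\<lambda>z. z ^ N * exp (w * z)) holomorphic_on UNIV"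
  by (intro holomorphic_intros)

lemma higher_deriv_exp_linear: "(deriv ^^ i) (\<lambda>z. exp (w * z)) z = w ^ i * exp (w * z)" for w z :: complex
proof (induction i arbitrary: z)
  case (Suc i)
  then have "(deriv ^^ i) (\<lambda>z. exp (w * z)) = (\<lambda>z. w ^ i * exp (w * z))" by auto
  then show ?case
    by (auto intro!: DERIV_imp_deriv derivative_eq_intros)
qed simp

text \<open>The Pochhammer symbol is the falling factorial N (N - 1) ... (N - j + 1) of the j-th
  derivative of z^N. For \<open>j > N\<close> truncated subtraction makes its first factor 0, so the
  spurious \<open>z ^ 0\<close> does no harm.\<close>

lemma higher_deriv_power_exp:
  "(deriv ^^ i) (\<lambda>z. z ^ N * exp (w * z)) z
    = (\<Sum>j\<le>i. of_nat (i choose j) * (pochhammer (of_nat (Suc N - j)) j * z ^ (N - j)) * (w ^ (i - j) * exp (w * z)))"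
  for w z :: complex
proof -
  have "(deriv ^^ i) (\<lambda>z. z ^ N * exp (w * z)) z
    = (\<Sum>j = 0..i. of_nat (i choose j) * (deriv ^^ j) (\<lambda>z. z ^ N) z * (deriv ^^ (i - j)) (\<lambda>z. exp (w * z)) z)"
    by (rule higher_deriv_mult[of _ UNIV]) (auto intro!: holomorphic_intros)
  then show ?thesis
    using higher_deriv_power[of _ 0 N z] by (simp add: higher_deriv_exp_linear atMost_atLeast0)
qed

lemma higher_deriv_power_exp_0:
  assumes "i \<le> N"
  shows "(deriv ^^ i) (\<lambda>z. z ^ N * exp (w * z)) (0 :: complex) = (if i = N then fact N else 0)"
proof -
  have "(deriv ^^ i) (\<lambda>z. z ^ N * exp (w * z)) (0 :: complex)
    = (\<Sum>j\<le>i. if j = N then fact N else 0)"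
    unfolding higher_deriv_power_exp
  proof (rule sum.cong[OF refl])
    fix j assume "j \<in> {..i}"
    then have "j = N \<longrightarrow> i = N" "j \<le> N" using assms by auto
    then show "of_nat (i choose j) * (pochhammer (of_nat (Suc N - j)) j * 0 ^ (N - j)) * (w ^ (i - j) * exp (w * 0))
      = (if j = N then fact N else 0)"
      by (auto simp: pochhammer_fact)
  qed
  then show ?thesis using assms by auto
qed

text \<open>The Leibniz terms contain at most \<open>Suc N\<close> powers of \<open>w\<close>. This
  is the origin of the growth exponent \<open>N + 1\<close> on vertical lines, and so of the
  condition \<open>real N + 1 < k\<close> in the first Perron formula.\<close>

lemma norm_higher_deriv_power_exp_le:
  obtains K :: real where "0 \<le> K" "\<And>w z. 0 \<le> z \<Longrightarrow>
    cmod ((deriv ^^ Suc N) (\<lambda>z. z ^ N * exp (w * z)) (of_real z))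
    \<le> K * (1 + cmod w) ^ Suc N * (1 + z) ^ N * exp (Re w * z)"
proof -
  define k where "k j = real (Suc N choose j) * cmod (pochhammer (of_nat (Suc N - j)) j)" for j
  have "cmod ((deriv ^^ Suc N) (\<lambda>z. z ^ N * exp (w * z)) (of_real z))
    \<le> (\<Sum>j\<le>Suc N. k j) * (1 + cmod w) ^ Suc N * (1 + z) ^ N * exp (Re w * z)" if "0 \<le> z" for w z
    unfolding higher_deriv_power_exp sum_distrib_right
  proof (rule sum_norm_le)
    fix j
    have "\<bar>z\<bar> ^ (N - j) \<le> (1 + z) ^ (N - j)" "(1 + z) ^ (N - j) \<le> (1 + z) ^ N"
      "cmod w ^ (Suc N - j) \<le> (1 + cmod w) ^ (Suc N - j)" "(1 + cmod w) ^ (Suc N - j) \<le> (1 + cmod w) ^ Suc N"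
      using that by (intro power_mono power_increasing; simp)+
    then have z: "\<bar>z\<bar> ^ (N - j) \<le> (1 + z) ^ N" and w: "cmod w ^ (Suc N - j) \<le> (1 + cmod w) ^ Suc N"
      by linarith+
    have "cmod (of_nat (Suc N choose j) * (pochhammer (of_nat (Suc N - j)) j * of_real z ^ (N - j))
        * (w ^ (Suc N - j) * exp (w * of_real z)))
      = k j * \<bar>z\<bar> ^ (N - j) * (cmod w ^ (Suc N - j) * exp (Re w * z))"
      by (simp add: k_def norm_mult norm_power ac_simps)
    also have "\<dots> \<le> k j * (1 + z) ^ N * ((1 + cmod w) ^ Suc N * exp (Re w * z))"
      using z w that by (intro mult_mono mult_left_mono mult_right_mono) (auto simp: k_def)
    finally show "cmod (of_nat (Suc N choose j) * (pochhammer (of_nat (Suc N - j)) j * of_real z ^ (N - j))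
        * (w ^ (Suc N - j) * exp (w * of_real z)))
      \<le> k j * (1 + cmod w) ^ Suc N * (1 + z) ^ N * exp (Re w * z)"
      by (simp only: ac_simps)
  qed
  moreover have "0 \<le> (\<Sum>j\<le>Suc N. k j)"
    by (intro sum_nonneg) (simp add: k_def)
  ultimately show thesis using that by blast
qed

text \<open>Taylor's formula for \<open>z\<^sup>N e\<^bsup>wz\<^esup>\<close>, all of whose derivatives of order below \<open>N\<close> vanish at 0.\<close>

lemma has_integral_power_exp:
  fixes w :: complex
  assumes "0 \<le> b"
  shows "((\<lambda>z. of_real ((b - z) ^ N / fact N) * (deriv ^^ Suc N) (\<lambda>z. z ^ N * exp (w * z)) (of_real z))
    has_integral (of_real b ^ N * exp (w * of_real b) - of_real b ^ N)) {0..b}"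
proof -
  let ?h = "\<lambda>z. z ^ N * exp (w * z)"
  define D where "D i t = (deriv ^^ i) ?h (complex_of_real t)" for i t
  have "((\<lambda>z. ((b - z) ^ (Suc N - 1) / fact (Suc N - 1)) *\<^sub>R D (Suc N) z) has_integral
      D 0 b - (\<Sum>i<Suc N. ((b - 0) ^ i / fact i) *\<^sub>R D i 0)) {0..b}"
  proof (rule Taylor_has_integral)
    fix m t
    have "(deriv ^^ m) ?h holomorphic_on UNIV"
      by (intro holomorphic_higher_deriv holomorphic_power_exp) auto
    then have "((deriv ^^ m) ?h has_field_derivative (deriv ^^ Suc m) ?h z) (at z)" for z
      using holomorphic_derivI[of _ UNIV z] by simp
    then show "(D m has_vector_derivative D (Suc m) t) (at t within {0..b})"
      unfolding D_def by (intro has_vector_derivative_real_field)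
  qed (use assms in auto)
  moreover have "(\<Sum>i<Suc N. ((b - 0) ^ i / fact i) *\<^sub>R D i 0) = (\<Sum>i<Suc N. if i = N then of_real b ^ N else 0)"
    by (intro sum.cong refl) (auto simp: D_def higher_deriv_power_exp_0 scaleR_conv_of_real)
  moreover have "D 0 b = of_real b ^ N * exp (w * of_real b)"
    by (simp add: D_def)
  ultimately show ?thesis
    by (simp add: D_def scaleR_conv_of_real del: funpow.simps)
qed

text \<open>Replacing b - z by its positive part makes the interval independent of \<open>b\<close>,
  so that the formula can be summed over all \<open>b = x - lam n\<close>. The condition
  \<open>0 < N\<close> ensures that the power vanishes beyond \<open>b\<close>.\<close>

lemma has_integral_power_exp_extend:
  fixes w :: complex
  assumes "0 \<le> b" "b \<le> x" "0 < N"
  shows "((\<lambda>z. of_real (max 0 (b - z) ^ N / fact N) * (deriv ^^ Suc N) (\<lambda>z. z ^ N * exp (w * z)) (of_real z))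
    has_integral (of_real b ^ N * exp (w * of_real b) - of_real b ^ N)) {0..x}"
proof -
  let ?F = "\<lambda>z. of_real (max 0 (b - z) ^ N / fact N) * (deriv ^^ Suc N) (\<lambda>z. z ^ N * exp (w * z)) (of_real z)"
  have 1: "(?F has_integral (of_real b ^ N * exp (w * of_real b) - of_real b ^ N)) {0..b}"
    by (rule has_integral_eq[OF _ has_integral_power_exp[OF assms(1)]]) (auto simp: max_def)
  have 2: "(?F has_integral 0) {b..x}"
    by (rule has_integral_is_0) (use assms in \<open>auto simp: max_def\<close>)
  show ?thesis
    using has_integral_combine[OF assms(1,2) 1 2] by (simp only: add_0_right)
qed

lemma has_integral_exp_tail_le:
  fixes d x :: real
  assumes "0 < d" "0 \<le> x"
  shows "(\<lambda>z. exp (- d * (x - z))) integrable_on {0..x}" "integral {0..x} (\<lambda>z. exp (- d * (x - z))) \<le> 1 / d"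
proof -
  have "((\<lambda>z. exp (- d * (x - z))) has_integral exp (- d * (x - x)) / d - exp (- d * (x - 0)) / d) {0..x}"
    by (rule fundamental_theorem_of_calculus)
      (use assms in \<open>auto intro!: derivative_eq_intros simp flip: has_real_derivative_iff_has_vector_derivative\<close>)
  then show "(\<lambda>z. exp (- d * (x - z))) integrable_on {0..x}" "integral {0..x} (\<lambda>z. exp (- d * (x - z))) \<le> 1 / d"
    using assms by (auto simp: integral_unique has_integral_integrable)
qed

lemma power_eq_riesz_weight:
  fixes y l :: real
  assumes "0 < y" "l < y"
  shows "(y - l) ^ N = y ^ N * (1 - l / y) powr real N"
proof -
  have "1 - l / y > 0" using assms by simp
  then have "y ^ N * (1 - l / y) powr real N = (y * (1 - l / y)) ^ N"
    by (simp add: powr_realpow power_mult_distrib)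
  also have "y * (1 - l / y) = y - l" using assms by (simp add: field_simps)
  finally show ?thesis by simp
qed

text \<open>After multiplication by x^N exp(xw), the mean at \<open>s0 + w\<close> is a sum of terms
  b^N exp(wb) with b = x - \<lambda>_n and the coefficients of the series at \<open>s0\<close>.
  Taylor's formula expresses b^N exp(wb) - b^N through the kernel (b - z)^N, cut off at z = b.
  Summed over n, these kernels form (x - z)^N times the mean at \<open>s0\<close> with parameter x -
  z, which \<open>M\<close> bounds. Since \<open>Re w = e > 0\<close>, the remaining integrand
  decays like a power of x - z times exp(- e (x - z)), and the integral stays bounded in
  \<open>x\<close>.\<close>

lemma riesz_mean_vline_bound:
  assumes lam: "frequency lam" and N: "0 < N" and e: "0 < e"
    and M: "\<And>x. 0 < x \<Longrightarrow> cmod (riesz_mean lam (real N) a x s0) \<le> M"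
  obtains B where "0 \<le> B" "\<And>x w. 1 \<le> x \<Longrightarrow> Re w = e \<Longrightarrow>
    cmod (riesz_mean lam (real N) a x (s0 + w)) \<le> B * (1 + cmod w) ^ Suc N"
proof -
  obtain K :: real where K: "0 \<le> K" "\<And>w z. 0 \<le> z \<Longrightarrow>
    cmod ((deriv ^^ Suc N) (\<lambda>z. z ^ N * exp (w * z)) (of_real z))
    \<le> K * (1 + cmod w) ^ Suc N * (1 + z) ^ N * exp (Re w * z)"
    using norm_higher_deriv_power_exp_le[of N] by blast
  have M0: "0 \<le> M" using order_trans[OF norm_ge_zero M[of 1]] by simp
  define c where "c n = a n * exp (- of_real (lam n) * s0)" for n
  \<comment> \<open>\<open>M\<close> bounds the means at \<open>s0\<close>, \<open>K\<close> the
    derivative; 2^N comes from 1 + z \<le> 2 x, valid as \<open>1 \<le> x\<close>, which lets x^N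
    cancel; the last factor is the price of absorbing (x - z)^N in half of the exponential
    decay.\<close>
  define Q where "Q = M * K / fact N * 2 ^ N * (real N / (e / 2)) ^ N"
  have Q0: "0 \<le> Q" unfolding Q_def using M0 K e by auto
  have "cmod (riesz_mean lam (real N) a x (s0 + w)) \<le> (M + Q * (2 / e)) * (1 + cmod w) ^ Suc N"
    if x: "1 \<le> x" and w: "Re w = e" for x w
  proof -
    define E where "E z = (deriv ^^ Suc N) (\<lambda>z. z ^ N * exp (w * z)) (complex_of_real z)" for z
    define T where "T z = (\<Sum>n | lam n < x. c n * of_real (max 0 (x - lam n - z) ^ N))" for z
    define A where "A = of_real (1 / x ^ N) * exp (- (of_real x * w))"
    define G where "G z = A * (T z / fact N * E z)" for z
    have T: "cmod (T z) \<le> M * (x - z) ^ N" if z: "0 \<le> z" "z \<le> x" for z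
    \<comment> \<open>At the endpoint the parameter x - z is 0, where \<open>M\<close> gives no
      bound; there every truncated power vanishes.\<close>
    proof (cases "z = x")
      case True
      then have "T z = 0"
        unfolding T_def using frequency_nonneg[OF lam] N by (intro sum.neutral) (auto simp: max_absorb1)
      then show ?thesis using True M0 by simp
    next
      case False
      with z have zx: "0 < x - z" by simp
      have "T z = (\<Sum>n | lam n < x - z. c n * of_real (max 0 (x - lam n - z) ^ N))"
        unfolding T_def using z N
        by (intro sum.mono_neutral_right frequency_finite[OF lam]) (auto simp: max_def)
      also have "\<dots> = of_real ((x - z) ^ N) * riesz_mean lam (real N) a (x - z) s0"
        unfolding riesz_mean_def sum_distrib_left c_def[symmetric]
      proof (rule sum.cong[OF refl])
        fix n assume "n \<in> {n. lam n < x - z}"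
        then have "max 0 (x - lam n - z) ^ N = (x - z) ^ N * (1 - lam n / (x - z)) powr real N"
          using power_eq_riesz_weight[OF zx, of "lam n" N] by (simp add: max_def algebra_simps)
        then show "c n * of_real (max 0 (x - lam n - z) ^ N)
          = of_real ((x - z) ^ N) * (c n * of_real ((1 - lam n / (x - z)) powr real N))"
          by simp
      qed
      finally have "cmod (T z) = (x - z) ^ N * cmod (riesz_mean lam (real N) a (x - z) s0)"
        using zx by (simp only: norm_mult norm_of_real abs_of_nonneg zero_le_power less_imp_le)
      also have "\<dots> \<le> (x - z) ^ N * M"
        using zx M[OF zx] by (intro mult_left_mono) auto
      finally show ?thesis by (simp add: mult.commute)
    qed
    have "((\<lambda>z. \<Sum>n | lam n < x. c n * (of_real (max 0 (x - lam n - z) ^ N / fact N) * E z)) has_integral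
        (\<Sum>n | lam n < x. c n * (of_real (x - lam n) ^ N * exp (w * of_real (x - lam n)) - of_real (x - lam n) ^ N))) {0..x}"
      unfolding E_def using frequency_nonneg[OF lam] N
      by (intro has_integral_sum frequency_finite[OF lam] has_integral_mult_right has_integral_power_exp_extend) auto
    moreover have "(\<Sum>n | lam n < x. c n * (of_real (max 0 (x - lam n - z) ^ N / fact N) * E z)) = T z / fact N * E z" for z
      unfolding T_def sum_distrib_right sum_divide_distrib by (intro sum.cong refl) simp
    ultimately have "(G has_integral A * (\<Sum>n | lam n < x. c n * (of_real (x - lam n) ^ N * exp (w * of_real (x - lam n)) - of_real (x - lam n) ^ N))) {0..x}"
      unfolding G_def by (intro has_integral_mult_right) simp
    moreover have "A * (\<Sum>n | lam n < x. c n * (of_real (x - lam n) ^ N * exp (w * of_real (x - lam n)) - of_real (x - lam n) ^ N))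
      = riesz_mean lam (real N) a x (s0 + w) - exp (- (of_real x * w)) * riesz_mean lam (real N) a x s0"
      unfolding riesz_mean_def sum_distrib_left sum_subtractf[symmetric]
    proof (rule sum.cong[OF refl])
      fix n assume n: "n \<in> {n. lam n < x}"
      have "of_real (x - lam n) ^ N = (of_real ((x - lam n) ^ N) :: complex)" by simp
      also have "(x - lam n) ^ N = x ^ N * (1 - lam n / x) powr real N"
        using n x by (intro power_eq_riesz_weight) auto
      finally have p: "of_real (x - lam n) ^ N = complex_of_real (x ^ N) * of_real ((1 - lam n / x) powr real N)"
        by (simp only: of_real_mult)
      have x0: "complex_of_real (1 / x ^ N) * of_real (x ^ N) = 1" using x by (simp flip: of_real_mult)
      have ex: "exp (- (of_real x * w)) * exp (w * of_real (x - lam n)) = exp (- of_real (lam n) * w)"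
        by (simp add: algebra_simps flip: exp_add)
      have es: "exp (- of_real (lam n) * (s0 + w)) = exp (- of_real (lam n) * s0) * exp (- of_real (lam n) * w)"
        by (simp add: algebra_simps flip: exp_add)
      have "i * X * (c * ((xN * r) * Y - xN * r)) = c * (X * Y) * r - X * (c * r)"
        if "i * xN = 1" for i X c xN r Y :: complex
      proof -
        have "i * X * (c * ((xN * r) * Y - xN * r)) = (i * xN) * (c * (X * Y) * r - X * (c * r))"
          by (simp add: algebra_simps)
        then show ?thesis by (simp add: that)
      qed
      from this[OF x0, where X = "exp (- (of_real x * w))" and c = "c n"
          and r = "of_real ((1 - lam n / x) powr real N)" and Y = "exp (w * of_real (x - lam n))"]
      show "A * (c n * (of_real (x - lam n) ^ N * exp (w * of_real (x - lam n)) - of_real (x - lam n) ^ N)) =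
         a n * exp (- of_real (lam n) * (s0 + w)) * of_real ((1 - lam n / x) powr real N)
         - exp (- (of_real x * w)) * (a n * exp (- of_real (lam n) * s0) * of_real ((1 - lam n / x) powr real N))"
        unfolding A_def p es ex c_def by (simp only: mult.assoc)
    qed
    ultimately have G: "(G has_integral riesz_mean lam (real N) a x (s0 + w)
        - exp (- (of_real x * w)) * riesz_mean lam (real N) a x s0) {0..x}" by simp
    have Gb: "cmod (G z) \<le> Q * (1 + cmod w) ^ Suc N * exp (- (e / 2) * (x - z))" if "z \<in> {0..x}" for z
    proof -
      from that have z: "0 \<le> z" "z \<le> x" by auto
      have A: "cmod A = 1 / x ^ N * exp (- (x * e))"
        unfolding A_def using x w by (simp add: norm_mult norm_divide norm_power)
      have "(1 + z) ^ N \<le> (2 * x) ^ N"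
        using z x by (intro power_mono) auto
      then have z2: "(1 + z) ^ N \<le> 2 ^ N * x ^ N" by (simp add: power_mult_distrib)
      have xz: "(x - z) ^ N \<le> (real N / (e / 2)) ^ N * exp (e / 2 * (x - z))"
        using z e by (intro power_le_exp) auto
      have "cmod (G z) = cmod A * (cmod (T z) / fact N * cmod (E z))"
        unfolding G_def by (simp add: norm_mult norm_divide)
      also have "\<dots> \<le> cmod A * (M * (x - z) ^ N / fact N * (K * (1 + cmod w) ^ Suc N * (1 + z) ^ N * exp (e * z)))"
        using T[OF z] K(2)[OF z(1), of w] w z M0 unfolding E_def
        by (intro mult_left_mono mult_mono divide_right_mono) auto
      also have "\<dots> \<le> cmod A * (M * ((real N / (e / 2)) ^ N * exp (e / 2 * (x - z))) / fact N
          * (K * (1 + cmod w) ^ Suc N * (2 ^ N * x ^ N) * exp (e * z)))"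
        using z2 xz z M0 K e
        by (intro mult_left_mono mult_mono divide_right_mono mult_right_mono mult_nonneg_nonneg) auto
      also have "\<dots> = Q * (1 + cmod w) ^ Suc N * ((1 / x ^ N * x ^ N) * (exp (- (x * e)) * exp (e / 2 * (x - z)) * exp (e * z)))"
        unfolding A Q_def by (simp only: ac_simps times_divide_eq_left times_divide_eq_right)
      also have "exp (- (x * e)) * exp (e / 2 * (x - z)) * exp (e * z) = exp (- (e / 2) * (x - z))"
        by (simp add: algebra_simps flip: exp_add)
      also have "1 / x ^ N * x ^ N = 1" using x by simp
      finally show ?thesis by simp
    qed
    have "cmod (integral {0..x} G) \<le> integral {0..x} (\<lambda>z. Q * (1 + cmod w) ^ Suc N * exp (- (e / 2) * (x - z)))"
    proof (rule Henstock_Kurzweil_Integration.integral_norm_bound_integral[OF has_integral_integrable[OF G] _ Gb])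
      show "(\<lambda>z. Q * (1 + cmod w) ^ Suc N * exp (- (e / 2) * (x - z))) integrable_on {0..x}"
        using has_integral_exp_tail_le(1)[of "e / 2" x] e x by (intro integrable_on_mult_right) auto
    qed
    also have "\<dots> = Q * (1 + cmod w) ^ Suc N * integral {0..x} (\<lambda>z. exp (- (e / 2) * (x - z)))"
      by (rule integral_mult_right)
    also have "\<dots> \<le> Q * (1 + cmod w) ^ Suc N * (2 / e)"
      using has_integral_exp_tail_le(2)[of "e / 2" x] e x Q0 by (intro mult_left_mono) auto
    finally have int: "cmod (riesz_mean lam (real N) a x (s0 + w)
        - exp (- (of_real x * w)) * riesz_mean lam (real N) a x s0) \<le> Q * (2 / e) * (1 + cmod w) ^ Suc N"
      using integral_unique[OF G] by (simp add: ac_simps)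
    have "cmod (exp (- (of_real x * w)) * riesz_mean lam (real N) a x s0) \<le> 1 * M"
      unfolding norm_mult using x w e M[of x] by (intro mult_mono) auto
    also have "\<dots> \<le> M * (1 + cmod w) ^ Suc N"
    proof -
      have "1 \<le> (1 + cmod w) ^ Suc N" by (rule one_le_power) simp
      from mult_left_mono[OF this M0] show ?thesis by simp
    qed
    finally show ?thesis
      using int norm_triangle_sub[of "riesz_mean lam (real N) a x (s0 + w)" "exp (- (of_real x * w)) * riesz_mean lam (real N) a x s0"]
      by (simp only: distrib_right)
  qed
  moreover have "0 \<le> M + Q * (2 / e)" using M0 Q0 e by simp
  ultimately show thesis using that by blast
qed

section \<open>The Perron formula for large order\<close>

text \<open>The mean at the point 0 without its factor y^(-k). In this normalization a derivative in
  \<open>y\<close> lowers the order by one, up to a constant.\<close>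

definition riesz_sum :: "(nat \<Rightarrow> real) \<Rightarrow> real \<Rightarrow> (nat \<Rightarrow> complex) \<Rightarrow> real \<Rightarrow> complex" where
  "riesz_sum lam k a y = (\<Sum>n | lam n < y. a n * of_real ((y - lam n) powr k))"

lemma exp_mult_perron_weight: "exp (- of_real l * s) * perron_weight k y s = perron_weight k (y - l) s"
proof -
  have "exp (- of_real l * s) * exp (of_real y * s) = exp (of_real (y - l) * s)"
    by (simp add: algebra_simps flip: exp_add)
  then show ?thesis unfolding perron_weight_def by (simp only: mult.assoc[symmetric])
qed

lemma continuous_riesz_mean:
  "continuous_on S (\<lambda>s. riesz_mean lam k a x s)"
  unfolding riesz_mean_def by (intro continuous_intros)

lemma perron_riesz_mean:
  assumes lam: "frequency lam" and c: "0 < c" "0 < k"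
  shows "perron c k (\<lambda>s. riesz_mean lam m a x s) y
    = (\<Sum>n | lam n < x. a n * of_real ((1 - lam n / x) powr m)
        * (if lam n < y then of_real ((y - lam n) powr k) * perron_const k else 0))"
proof -
  have "riesz_mean lam m a x s * perron_weight k y s
    = (\<Sum>n | lam n < x. a n * of_real ((1 - lam n / x) powr m) * perron_weight k (y - lam n) s)" for s
    unfolding riesz_mean_def sum_distrib_right exp_mult_perron_weight[symmetric]
    by (intro sum.cong refl) (simp only: ac_simps)
  then have "perron c k (\<lambda>s. riesz_mean lam m a x s) y
    = (\<Sum>n | lam n < x. a n * of_real ((1 - lam n / x) powr m) * (LINT t|lborel. perron_weight k (y - lam n) (Complex c t)))"
    unfolding perron_def using perron_one_integrable[OF c]
    by (simp add: Bochner_Integration.integral_sum)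
  moreover have "(LINT t|lborel. perron_weight k (y - lam n) (Complex c t)) = perron c k (\<lambda>_. 1) (y - lam n)" for n
    unfolding perron_def by simp
  ultimately show ?thesis
    by (simp add: perron_one[OF c])
qed

text \<open>For the means, which are finite sums, the formula holds term by term. As
  \<open>x\<close> tends to infinity, the cut-off at \<open>y\<close> keeps the arithmetic side
  finite and its weights tend to 1. On the integral side the bound with exponent
  \<open>N + 1\<close> is uniform in \<open>x\<close>, and \<open>real N + 1 < k\<close> allows
  dominated convergence.\<close>

lemma perron_formula_large_order:
  assumes lam: "frequency lam" and N: "0 < N" and \<sigma>: "0 \<le> \<sigma>" "\<sigma> < c" and k: "real N + 1 < k"
    and cont: "continuous_on (right_half_plane 0) f"
    and lim: "\<And>s. Re s > \<sigma> \<Longrightarrow> ((\<lambda>x. riesz_mean lam (real N) a x s) \<longlongrightarrow> f s) at_top"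
  shows "perron c k f y = perron_const k * riesz_sum lam k a y"
proof -
  \<comment> \<open>\<open>s0\<close> lies midway between the abscissa \<sigma> and the line: the
    means still converge there, and \<open>e\<close> remains as the real part of the displacement
    \<open>w\<close>.\<close>
  define e where "e = (c - \<sigma>) / 2"
  have e: "0 < e" using \<sigma> by (simp add: e_def)
  define s0 where "s0 = complex_of_real (\<sigma> + e)"
  have lim0: "((\<lambda>x. riesz_mean lam (real N) a x s0) \<longlongrightarrow> f s0) at_top"
    using e by (intro lim) (simp add: s0_def)
  obtain M where M: "\<And>x. 0 < x \<Longrightarrow> cmod (riesz_mean lam (real N) a x s0) \<le> M"
    using riesz_mean_bounded[OF lam of_nat_0_le_iff lim0] by blast
  obtain B where B: "0 \<le> B" "\<And>x w. 1 \<le> x \<Longrightarrow> Re w = e \<Longrightarrow>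
    cmod (riesz_mean lam (real N) a x (s0 + w)) \<le> B * (1 + cmod w) ^ Suc N"
    using riesz_mean_vline_bound[OF lam N e M] by blast
  define W where "W = B * (1 + e) ^ Suc N"
  have bd: "cmod (riesz_mean lam (real N) a x (Complex c t)) \<le> W * (1 + \<bar>t\<bar>) powr (real N + 1)" if "1 \<le> x" for x t
  proof -
    have "s0 + Complex e t = Complex c t"
      unfolding s0_def e_def by (simp add: complex_eq_iff field_simps)
    then have "cmod (riesz_mean lam (real N) a x (Complex c t)) \<le> B * (1 + cmod (Complex e t)) ^ Suc N"
      using B(2)[OF that, of "Complex e t"] by simp
    also have "\<dots> \<le> B * ((1 + e) * (1 + \<bar>t\<bar>)) ^ Suc N"
    proof (intro mult_left_mono power_mono B)
      have "cmod (Complex e t) \<le> \<bar>e\<bar> + \<bar>t\<bar>"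
        using cmod_le[of "Complex e t"] by simp
      moreover have "0 \<le> e * \<bar>t\<bar>" using e by simp
      ultimately show "1 + cmod (Complex e t) \<le> (1 + e) * (1 + \<bar>t\<bar>)"
        unfolding distrib_left distrib_right mult_1_left mult_1_right using e by linarith
    qed auto
    also have "\<dots> = W * (1 + \<bar>t\<bar>) powr real (Suc N)"
      unfolding W_def power_mult_distrib by (subst powr_realpow) auto
    finally show ?thesis by (simp add: add.commute)
  qed
  have "((\<lambda>x. perron c k (\<lambda>s. riesz_mean lam (real N) a x s) y) \<longlongrightarrow> perron c k f y) at_top"
    unfolding perron_def
  proof (rule integral_dominated_convergence_at_top)
    have c: "0 < c" using \<sigma> by simp
    show "(\<lambda>t. f (Complex c t) * perron_weight k y (Complex c t)) \<in> borel_measurable lborel"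
      using measurable_vline[where F = "\<lambda>s. f s * perron_weight k y s", OF _ c] cont
      by (simp add: continuous_on_mult continuous_perron_weight)
    show "(\<lambda>t. riesz_mean lam (real N) a x (Complex c t) * perron_weight k y (Complex c t)) \<in> borel_measurable lborel" for x
      using measurable_vline[where F = "\<lambda>s. riesz_mean lam (real N) a x s * perron_weight k y s", OF _ c]
      by (simp add: continuous_on_mult continuous_perron_weight continuous_riesz_mean)
    show "integrable lborel (\<lambda>t. W * exp (y * c) * (min 1 c / 2) powr - (k + 1) * (1 + \<bar>t\<bar>) powr - (k + 1 - (real N + 1)))"
      using k by (intro integrable_mult_right integrable_one_plus_abs_powr) auto
    show "AE t in lborel. ((\<lambda>x. riesz_mean lam (real N) a x (Complex c t) * perron_weight k y (Complex c t))
        \<longlongrightarrow> f (Complex c t) * perron_weight k y (Complex c t)) at_top"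
      using \<sigma> by (intro AE_I2 tendsto_mult tendsto_const lim) auto
    show "\<forall>\<^sub>F x in at_top. AE t in lborel. norm (riesz_mean lam (real N) a x (Complex c t) * perron_weight k y (Complex c t))
        \<le> W * exp (y * c) * (min 1 c / 2) powr - (k + 1) * (1 + \<bar>t\<bar>) powr - (k + 1 - (real N + 1))"
      using eventually_ge_at_top[of 1]
    proof eventually_elim
      case (elim x)
      have "norm (riesz_mean lam (real N) a x (Complex c t) * perron_weight k y (Complex c t))
        \<le> W * exp (y * c) * (min 1 c / 2) powr - (k + 1) * (1 + \<bar>t\<bar>) powr - (k + 1 - (real N + 1))" for t
        using perron_integrand_bound[of c "Complex c t" k "riesz_mean lam (real N) a x" W "real N + 1" y] c k bd[OF elim]
        by simp
      then show ?case by simp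
    qed
  qed
  moreover have "((\<lambda>x. perron c k (\<lambda>s. riesz_mean lam (real N) a x s) y) \<longlongrightarrow> perron_const k * riesz_sum lam k a y) at_top"
  proof (rule Lim_transform_eventually)
    have "((\<lambda>x. \<Sum>n | lam n < y. a n * of_real ((1 - lam n / x) powr real N) * (of_real ((y - lam n) powr k) * perron_const k))
       \<longlongrightarrow> (\<Sum>n | lam n < y. a n * of_real ((1 - 0) powr real N) * (of_real ((y - lam n) powr k) * perron_const k))) at_top"
      by (intro tendsto_intros tendsto_divide_0[OF tendsto_const] filterlim_at_top_imp_at_infinity filterlim_ident) auto
    then show "((\<lambda>x. \<Sum>n | lam n < y. a n * of_real ((1 - lam n / x) powr real N) * (of_real ((y - lam n) powr k) * perron_const k))
       \<longlongrightarrow> perron_const k * riesz_sum lam k a y) at_top"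
      unfolding riesz_sum_def sum_distrib_left by (simp add: ac_simps)
    show "\<forall>\<^sub>F x in at_top. (\<Sum>n | lam n < y. a n * of_real ((1 - lam n / x) powr real N) * (of_real ((y - lam n) powr k) * perron_const k))
      = perron c k (\<lambda>s. riesz_mean lam (real N) a x s) y"
      using eventually_ge_at_top[of y]
    proof eventually_elim
      case (elim x)
      have "perron c k (\<lambda>s. riesz_mean lam (real N) a x s) y =
         (\<Sum>n | lam n < x. a n * of_real ((1 - lam n / x) powr real N)
        * (if lam n < y then of_real ((y - lam n) powr k) * perron_const k else 0))"
        using \<sigma> k by (intro perron_riesz_mean[OF lam]) auto
      also have "\<dots> = (\<Sum>n | lam n < y. a n * of_real ((1 - lam n / x) powr real N) * (of_real ((y - lam n) powr k) * perron_const k))"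
        using elim by (intro sum.mono_neutral_cong_right frequency_finite[OF lam]) auto
      finally show ?case by simp
    qed
  qed
  ultimately show ?thesis
    by (rule tendsto_unique[OF trivial_limit_at_top_linorder])
qed

section \<open>Lowering the order by differentiation\<close>

text \<open>The positive part lets one formula cover frequencies on both sides of \<open>y\<close>.
  The critical case is \<open>u = 0\<close>, where the quotient is \<open>(1 / Suc n) powr k\<close>
  and tends to 0 because \<open>0 < k\<close>.\<close>

lemma pos_part_powr_difference_quotient:
  assumes "(0::real) < k"
  shows "(\<lambda>n. (max 0 (u + 1 / Suc n) powr (k + 1) - max 0 u powr (k + 1)) * real (Suc n))
    \<longlonglongrightarrow> (k + 1) * max 0 u powr k"
proof (cases "0 \<le> u")
  case False
  have "\<forall>\<^sub>F n in sequentially. 1 / real (Suc n) < - u"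
    by (rule order_tendstoD[OF LIMSEQ_Suc[OF lim_1_over_n]]) (use False in auto)
  then have "\<forall>\<^sub>F n in sequentially.
      (max 0 (u + 1 / Suc n) powr (k + 1) - max 0 u powr (k + 1)) * real (Suc n) = (k + 1) * max 0 u powr k"
    by (rule eventually_mono) (use False in \<open>simp add: max_absorb1 del: of_nat_Suc\<close>)
  then show ?thesis by (rule tendsto_eventually)
next
  case u: True
  have h: "(\<lambda>n. 1 / real (Suc n)) \<longlonglongrightarrow> 0"
    by (intro LIMSEQ_Suc lim_1_over_n)
  show ?thesis
  proof (cases "u = 0")
    case True
    have "(\<lambda>n. (1 / real (Suc n)) powr k) \<longlonglongrightarrow> 0"
      using h assms by (intro tendsto_zero_powrI[OF _ tendsto_const]) auto
    moreover have "(max 0 (u + 1 / Suc n) powr (k + 1) - max 0 u powr (k + 1)) * real (Suc n) = (1 / real (Suc n)) powr k" for n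
      using True by (simp add: max_absorb2 powr_add del: of_nat_Suc)
    ultimately show ?thesis using True by simp
  next
    case False
    with u have u: "0 < u" by simp
    have "((\<lambda>u. u powr (k + 1)) has_real_derivative (k + 1) * u powr k) (at u)"
      using has_real_derivative_powr[OF u, of "k + 1"] by simp
    then have lim: "((\<lambda>h. ((u + h) powr (k + 1) - u powr (k + 1)) / h) \<longlongrightarrow> (k + 1) * u powr k) (at 0)"
      unfolding DERIV_def .
    have "filterlim (\<lambda>n. 1 / real (Suc n)) (at 0) sequentially"
      unfolding filterlim_at using h by (auto intro!: always_eventually simp del: of_nat_Suc)
    from filterlim_compose[OF lim this] show ?thesis
      using u by (simp add: max_absorb2 del: of_nat_Suc)
  qed
qed

lemma riesz_sum_difference_quotient:
  assumes lam: "frequency lam" and k: "0 < k"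
  shows "(\<lambda>n. (riesz_sum lam (k + 1) a (y + 1 / Suc n) - riesz_sum lam (k + 1) a y) * of_nat (Suc n))
    \<longlonglongrightarrow> of_real (k + 1) * riesz_sum lam k a y"
proof -
  \<comment> \<open>The increments are at most 1, so the index set for \<open>y + 1\<close> serves
    all of them; the additional terms are powers of 0.\<close>
  have eq: "riesz_sum lam q a z = (\<Sum>n | lam n < y + 1. a n * of_real (max 0 (z - lam n) powr q))"
    if "z \<le> y + 1" for z q
    unfolding riesz_sum_def using that
    by (intro sum.mono_neutral_cong_left frequency_finite[OF lam]) auto
  have "(\<lambda>i. \<Sum>n | lam n < y + 1. a n * of_real ((max 0 (y - lam n + 1 / Suc i) powr (k + 1)
        - max 0 (y - lam n) powr (k + 1)) * real (Suc i)))
     \<longlonglongrightarrow> (\<Sum>n | lam n < y + 1. a n * of_real ((k + 1) * max 0 (y - lam n) powr k))"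
    by (intro tendsto_sum tendsto_mult_left tendsto_of_real pos_part_powr_difference_quotient k)
  moreover have "(\<Sum>n | lam n < y + 1. a n * of_real ((max 0 (y - lam n + 1 / Suc i) powr (k + 1)
        - max 0 (y - lam n) powr (k + 1)) * real (Suc i)))
     = (riesz_sum lam (k + 1) a (y + 1 / Suc i) - riesz_sum lam (k + 1) a y) * of_nat (Suc i)" for i
  proof -
    have "y + 1 / Suc i \<le> y + 1" by simp
    moreover have *: "y - lam n + 1 / Suc i = y + 1 / Suc i - lam n" for n by simp
    ultimately show ?thesis
      unfolding * by (simp add: eq sum_subtractf[symmetric] sum_distrib_right right_diff_distrib left_diff_distrib
          mult.assoc del: of_nat_Suc)
  qed
  moreover have "(\<Sum>n | lam n < y + 1. a n * of_real ((k + 1) * max 0 (y - lam n) powr k))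
     = of_real (k + 1) * riesz_sum lam k a y"
    by (simp add: eq sum_distrib_left ac_simps)
  ultimately show ?thesis by simp
qed

text \<open>The constant \<open>C\<close> is left arbitrary because the identity
  \<open>C * of_real (k + 1) = perron_const k\<close> is itself deduced from this lemma, applied to
  the constant function 1.\<close>

lemma perron_formula_descend:
  assumes lam: "frequency lam" and f: "continuous_on (right_half_plane 0) f" and c: "0 < c" and k: "0 < k" "q < k"
    and bd: "\<And>t. cmod (f (Complex c t)) \<le> B * (1 + \<bar>t\<bar>) powr q"
    and eq: "\<And>y. perron c (k + 1) f y = C * riesz_sum lam (k + 1) a y"
  shows "perron c k f y = C * of_real (k + 1) * riesz_sum lam k a y"
proof -
  have "(\<lambda>n. (perron c (k + 1) f (y + 1 / Suc n) - perron c (k + 1) f y) * of_nat (Suc n)) \<longlonglongrightarrow> perron c k f y"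
    using k by (intro perron_difference_quotient[OF f c _ _ bd]) auto
  moreover have "(\<lambda>n. C * ((riesz_sum lam (k + 1) a (y + 1 / Suc n) - riesz_sum lam (k + 1) a y) * of_nat (Suc n)))
    \<longlonglongrightarrow> C * (of_real (k + 1) * riesz_sum lam k a y)"
    by (intro tendsto_mult_left riesz_sum_difference_quotient lam k)
  ultimately show ?thesis
    unfolding eq by (intro LIMSEQ_unique) (simp_all add: right_diff_distrib left_diff_distrib mult.assoc)
qed

text \<open>In terms of Gamma this is its functional equation. Here it results from a single descent
  for the constant function 1, viewed as a series over the frequency \<open>real\<close> whose only
  nonzero coefficient has index 0.\<close>

lemma perron_const_Suc:
  assumes "0 < k"
  shows "perron_const k = perron_const (k + 1) * of_real (k + 1)"
proof -
  define a :: "nat \<Rightarrow> complex" where "a n = (if n = 0 then 1 else 0)" for n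
  have lam: "frequency real"
    unfolding frequency_def by (auto simp: strict_mono_def filterlim_real_sequentially)
  have sum: "riesz_sum real q a y = (if 0 < y then of_real (y powr q) else 0)" for q y
  proof -
    have "riesz_sum real q a y = (\<Sum>n | real n < y. if n = 0 then of_real (y powr q) else 0)"
      unfolding riesz_sum_def a_def by (intro sum.cong) auto
    then show ?thesis using frequency_finite[OF lam, of y] by simp
  qed
  have "perron 1 k (\<lambda>_. 1) 1 = perron_const (k + 1) * of_real (k + 1) * riesz_sum real k a 1"
    by (rule perron_formula_descend[OF lam, where q = 0 and B = 1])
      (use assms in \<open>auto simp: sum perron_one\<close>)
  then show ?thesis by (simp add: sum perron_const_def)
qed

section \<open>The Perron formula for every order above the growth exponent, and uniqueness\<close>

lemma riesz_germ_integer_order: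
  assumes "frequency lam" "riesz_germ lam a f"
  obtains N \<sigma> where "0 < (N::nat)" "0 \<le> \<sigma>"
    "\<And>s. Re s > \<sigma> \<Longrightarrow> ((\<lambda>x. riesz_mean lam (real N) a x s) \<longlongrightarrow> f s) at_top"
proof -
  obtain m \<sigma> where m: "0 \<le> m" "0 \<le> \<sigma>"
    "\<And>s. Re s > \<sigma> \<Longrightarrow> ((\<lambda>x. riesz_mean lam m a x s) \<longlongrightarrow> f s) at_top"
    using assms(2) unfolding riesz_germ_def by auto
  \<comment> \<open>Raising by the Beta average adds at least 1 to the order; rounding up and adding
    1 leaves \<open>q \<ge> 0\<close>, and makes \<open>N\<close> positive.\<close>
  define N where "N = nat \<lceil>m\<rceil> + 1"
  define q where "q = real N - m - 1"
  have "0 \<le> q" unfolding q_def N_def using m(1) by linarith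
  moreover have "real N = m + q + 1" by (simp add: q_def)
  ultimately have "((\<lambda>x. riesz_mean lam (real N) a x s) \<longlongrightarrow> f s) at_top" if "Re s > \<sigma>" for s
    using riesz_mean_raise[OF assms(1) m(1) _ m(3)[OF that], of q] by simp
  then show thesis using that[of N \<sigma>] m(2) by (simp add: N_def)
qed

lemma growth_on_strip:
  assumes "0 \<le> l" "0 \<le> M" "0 \<le> Re s" "Re s \<le> b" and f: "cmod (f s) \<le> M * (1 + cmod s) powr l"
  shows "cmod (f s) \<le> M * (1 + b) powr l * (1 + \<bar>Im s\<bar>) powr l"
proof -
  have "1 + cmod s \<le> (1 + b) * (1 + \<bar>Im s\<bar>)"
  proof -
    have "cmod s \<le> \<bar>Re s\<bar> + \<bar>Im s\<bar>" by (rule cmod_le)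
    moreover have "0 \<le> b * \<bar>Im s\<bar>" using assms by simp
    ultimately show ?thesis
      unfolding distrib_left distrib_right mult_1_left mult_1_right using assms by linarith
  qed
  then have "(1 + cmod s) powr l \<le> ((1 + b) * (1 + \<bar>Im s\<bar>)) powr l"
    using assms by (intro powr_mono2) auto
  then have "M * (1 + cmod s) powr l \<le> M * ((1 + b) powr l * (1 + \<bar>Im s\<bar>) powr l)"
    using assms(2) by (intro mult_left_mono) (simp_all add: powr_mult)
  then show ?thesis using f by (simp add: mult.assoc)
qed

text \<open>The formula holds at first for large order, on a line in the half plane of summability.
  Differentiating in \<open>y\<close> lowers the order down to \<open>k\<close>, after which the growth of \<open>f\<close> permits moving the
  line.\<close>

lemma perron_formula:
  assumes lam: "frequency lam" and germ: "riesz_germ lam a f" and l: "0 \<le> l" "l < k" and c: "0 < c"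
    and M: "0 \<le> M" "\<And>s. 0 < Re s \<Longrightarrow> cmod (f s) \<le> M * (1 + cmod s) powr l"
  shows "perron c k f y = perron_const k * riesz_sum lam k a y"
proof -
  have hol: "f holomorphic_on right_half_plane 0"
    using germ unfolding riesz_germ_def by blast
  then have cont: "continuous_on (right_half_plane 0) f"
    by (rule holomorphic_on_imp_continuous_on)
  obtain N \<sigma> where N: "0 < (N::nat)" "0 \<le> \<sigma>"
    "\<And>s. Re s > \<sigma> \<Longrightarrow> ((\<lambda>x. riesz_mean lam (real N) a x s) \<longlongrightarrow> f s) at_top"
    using riesz_germ_integer_order[OF lam germ] by blast
  \<comment> \<open>A line inside the half plane of summability and not to the left of the target
    line, so that a shift to the left ends the proof.\<close>
  define b where "b = max c (\<sigma> + 1)"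
  have b: "\<sigma> < b" "c \<le> b" "0 < b" using N(2) by (auto simp: b_def)
  have bd: "cmod (f s) \<le> M * (1 + b) powr l * (1 + \<bar>Im s\<bar>) powr l" if "0 < Re s" "Re s \<le> b" for s
    using that M l by (intro growth_on_strip) auto
  have "\<forall>y. perron b (k + real j) f y = perron_const (k + real j) * riesz_sum lam (k + real j) a y"
    if "j \<le> N + 1" for j
    using that
  \<comment> \<open>Downward induction from \<open>N + 1\<close>: the initial order
    \<open>k + N + 1\<close> exceeds \<open>N + 1\<close> because \<open>k\<close> is
    positive.\<close>
  proof (induction j rule: inc_induct)
    case base
    show ?case
      using l by (intro allI perron_formula_large_order[OF lam N(1,2) b(1) _ cont N(3)]) auto
  next
    case (step j)
    have e: "k + real (Suc j) = (k + real j) + 1" by simp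
    show ?case
    proof
      fix y
      have "perron b (k + real j) f y
        = perron_const (k + real j + 1) * of_real (k + real j + 1) * riesz_sum lam (k + real j) a y"
        using step.IH l b bd[of "Complex b t" for t] unfolding e
        by (intro perron_formula_descend[OF lam cont, where q = l and B = "M * (1 + b) powr l"]) auto
      then show "perron b (k + real j) f y = perron_const (k + real j) * riesz_sum lam (k + real j) a y"
        using perron_const_Suc[of "k + real j"] l by simp
    qed
  qed
  from this[of 0] have "perron b k f y = perron_const k * riesz_sum lam k a y" by simp
  moreover have "perron c k f y = perron b k f y"
    using l c b bd by (intro perron_shift[OF hol, where q = l and B = "M * (1 + b) powr l"]) auto
  ultimately show ?thesis by simp
qed

text \<open>Division by the nonzero Perron constant shows that \<open>f\<close> determines every
  Riesz sum. At \<open>y = lam (Suc n)\<close> exactly the indices up to \<open>n\<close> occur, and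
  the last of them has a nonzero weight, so the coefficients are recovered one after
  another.\<close>

lemma riesz_germ_unique:
  assumes lam: "frequency lam" and germ: "riesz_germ lam a f" "riesz_germ lam b f" and l: "0 \<le> l"
    and M: "0 \<le> M" "\<And>s. 0 < Re s \<Longrightarrow> cmod (f s) \<le> M * (1 + cmod s) powr l"
  shows "a = b"
proof
  fix n
  have pos: "0 < l + 1" using l by simp
  have "perron_const (l + 1) * riesz_sum lam (l + 1) a y = perron_const (l + 1) * riesz_sum lam (l + 1) b y" for y
    using perron_formula[OF lam germ(1) l _ zero_less_one M, of "l + 1" y]
      perron_formula[OF lam germ(2) l _ zero_less_one M, of "l + 1" y] by auto
  then have eq: "riesz_sum lam (l + 1) a y = riesz_sum lam (l + 1) b y" for y
    using perron_const_nonzero[OF pos] by simp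
  have mono: "strict_mono lam" using lam unfolding frequency_def by blast
  have set: "{i. lam i < lam (Suc n)} = insert n {..<n}" for n
    using strict_mono_less[OF mono] by auto
  show "a n = b n"
  proof (induction n rule: less_induct)
    case (less n)
    have "lam n < lam (Suc n)" using strict_mono_less[OF mono] by simp
    moreover have "a n * of_real ((lam (Suc n) - lam n) powr (l + 1)) = b n * of_real ((lam (Suc n) - lam n) powr (l + 1))"
      using eq[of "lam (Suc n)"] less unfolding riesz_sum_def set by simp
    ultimately show ?case by simp
  qed
qed

section \<open>The estimate at the point 0\<close>

text \<open>After rescaling, |s| is at least 1 on the line, so 1 + |s| / x is at most (1 + 1 / x0)
  |s|. The lower bound \<open>x0\<close> keeps this factor under control; the growth of
  \<open>f\<close> then costs \<open>l\<close> powers of |s| in an integral independent of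
  \<open>x\<close>.\<close>

lemma perron_bound:
  assumes cont: "continuous_on (right_half_plane 0) f" and l: "0 \<le> l" "l < k" and x0: "0 < x0" "x0 \<le> x"
    and M: "0 \<le> M" "\<And>s. 0 < Re s \<Longrightarrow> cmod (f s) \<le> M * (1 + cmod s) powr l"
  shows "cmod (perron (1 / x) k f x)
    \<le> x powr k * (M * (1 + 1 / x0) powr l * exp 1 * (LINT t|lborel. cmod (Complex 1 t) powr - (k - l + 1)))"
proof -
  have x: "0 < x" using x0 by simp
  define g where "g s = f (of_real (1 / x) * s)" for s
  define D where "D = M * (1 + 1 / x0) powr l"
  have "perron (1 / x * 1) k f x = of_real ((1 / x) powr - k) * perron 1 k g (1 / x * x)"
    unfolding g_def using x by (intro perron_scale) auto
  moreover have "(1 / x) powr - k = x powr k"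
    using x by (simp add: powr_divide powr_minus_divide)
  ultimately have eq: "cmod (perron (1 / x) k f x) = x powr k * cmod (perron 1 k g 1)"
    using x by (simp add: norm_mult)
  have g: "cmod (g (Complex 1 t)) \<le> D * cmod (Complex 1 t) powr l" for t
  proof -
    let ?s = "Complex 1 t"
    have s: "1 \<le> cmod ?s" using complex_Re_le_cmod[of ?s] by simp
    have "cmod ?s / x \<le> cmod ?s / x0" using x0 by (intro divide_left_mono) auto
    then have "1 + cmod (of_real (1 / x) * ?s) \<le> (1 + 1 / x0) * cmod ?s"
      using s x by (simp add: norm_mult norm_divide distrib_right)
    then have "(1 + cmod (of_real (1 / x) * ?s)) powr l \<le> ((1 + 1 / x0) * cmod ?s) powr l"
      using l by (intro powr_mono2) auto
    then have "M * (1 + cmod (of_real (1 / x) * ?s)) powr l \<le> D * cmod ?s powr l"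
      unfolding D_def mult.assoc powr_mult[symmetric] using M(1) by (rule mult_left_mono)
    then show ?thesis
      unfolding g_def using M(2)[of "of_real (1 / x) * ?s"] x by simp
  qed
  have cg: "continuous_on (right_half_plane 0) g"
    unfolding g_def using x by (intro continuous_on_compose2[OF cont] continuous_intros) auto
  have "cmod (perron 1 k g 1) \<le> (LINT t|lborel. D * exp 1 * cmod (Complex 1 t) powr - (k - l + 1))"
    unfolding perron_def
  proof (rule Bochner_Integration.integral_norm_bound_integral)
    have "integrable lborel (\<lambda>t. cmod (perron_weight (k - l) 0 (Complex 1 t)))"
      using perron_one_integrable[of 1 "k - l" 0] l by simp
    then show int: "integrable lborel (\<lambda>t. D * exp 1 * cmod (Complex 1 t) powr - (k - l + 1))"
      unfolding norm_perron_weight by simp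
    show le: "cmod (g (Complex 1 t) * perron_weight k 1 (Complex 1 t)) \<le> D * exp 1 * cmod (Complex 1 t) powr - (k - l + 1)" for t
    proof -
      have "cmod (g (Complex 1 t) * perron_weight k 1 (Complex 1 t))
        \<le> D * cmod (Complex 1 t) powr l * (exp 1 * cmod (Complex 1 t) powr - (k + 1))"
        unfolding norm_mult norm_perron_weight using g[of t] by (simp add: mult_right_mono)
      also have "\<dots> = D * exp 1 * (cmod (Complex 1 t) powr l * cmod (Complex 1 t) powr - (k + 1))"
        by (simp only: ac_simps)
      also have "cmod (Complex 1 t) powr l * cmod (Complex 1 t) powr - (k + 1) = cmod (Complex 1 t) powr - (k - l + 1)"
        by (simp add: algebra_simps flip: powr_add)
      finally show ?thesis .
    qed
    have "(\<lambda>t. g (Complex 1 t) * perron_weight k 1 (Complex 1 t)) \<in> borel_measurable borel"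
      by (rule measurable_vline[where F = "\<lambda>s. g s * perron_weight k 1 s"])
        (intro continuous_on_mult cg continuous_perron_weight, simp)
    then show "integrable lborel (\<lambda>t. g (Complex 1 t) * perron_weight k 1 (Complex 1 t))"
      using le by (intro Bochner_Integration.integrable_bound[OF int]) (auto intro: order_trans[OF _ abs_ge_self])
  qed
  then have "cmod (perron 1 k g 1) \<le> D * exp 1 * (LINT t|lborel. cmod (Complex 1 t) powr - (k - l + 1))"
    by simp
  then show ?thesis unfolding eq D_def by (rule mult_left_mono) simp
qed

lemma riesz_mean_at_0: 
  assumes "0 < x"
  shows "riesz_mean lam k a x 0 = of_real (x powr - k) * riesz_sum lam k a x"
  unfolding riesz_mean_def riesz_sum_def sum_distrib_left
proof (rule sum.cong[OF refl])
  fix n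
  have "1 - lam n / x = (x - lam n) / x" using assms by (simp add: field_simps)
  then have "(1 - lam n / x) powr k = x powr - k * (x - lam n) powr k"
    by (simp add: powr_divide powr_minus_divide)
  then show "a n * exp (- of_real (lam n) * 0) * of_real ((1 - lam n / x) powr k)
    = of_real (x powr - k) * (a n * of_real ((x - lam n) powr k))" by simp
qed

lemma riesz_mean_at_0_bound:
  assumes lam: "frequency lam" and l: "0 \<le> l" "l < k" and x0: "0 < x0"
  obtains C where "0 < C"
    "\<And>a f M x. riesz_germ lam a f \<Longrightarrow> 0 \<le> M \<Longrightarrow> (\<And>s. 0 < Re s \<Longrightarrow> cmod (f s) \<le> M * (1 + cmod s) powr l)
      \<Longrightarrow> x0 \<le> x \<Longrightarrow> cmod (riesz_mean lam k a x 0) \<le> C * M"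
proof -
  define D where "D = (1 + 1 / x0) powr l * exp 1 * (LINT t|lborel. cmod (Complex 1 t) powr - (k - l + 1))"
  define p where "p = cmod (perron_const k)"
  have p: "0 < p" unfolding p_def using perron_const_nonzero[of k] l by simp
  have D: "0 \<le> D" unfolding D_def
    by (intro mult_nonneg_nonneg Bochner_Integration.integral_nonneg) auto
  \<comment> \<open>Adding 1 makes the constant positive, as \<open>D\<close> is only known to be
    nonnegative.\<close>
  have "cmod (riesz_mean lam k a x 0) \<le> (D / p + 1) * M"
    if germ: "riesz_germ lam a f" and M: "0 \<le> M" "\<And>s. 0 < Re s \<Longrightarrow> cmod (f s) \<le> M * (1 + cmod s) powr l" and x: "x0 \<le> x"
    for a f M x
  proof -
    have xp: "0 < x" using x x0 by simp
    have cont: "continuous_on (right_half_plane 0) f"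
      using germ unfolding riesz_germ_def by (blast intro: holomorphic_on_imp_continuous_on)
    have "perron (1 / x) k f x = perron_const k * riesz_sum lam k a x"
      using xp by (intro perron_formula[OF lam germ l _ M]) auto
    then have "p * cmod (riesz_sum lam k a x) = cmod (perron (1 / x) k f x)"
      by (simp add: p_def norm_mult)
    also have "\<dots> \<le> x powr k * (M * D)"
      using perron_bound[OF cont l x0 x M] by (simp add: D_def mult.assoc)
    finally have sum_le: "cmod (riesz_sum lam k a x) \<le> x powr k * (M * D) / p"
      using p by (simp add: pos_le_divide_eq mult.commute)
    have "cmod (riesz_mean lam k a x 0) = x powr - k * cmod (riesz_sum lam k a x)"
      by (simp add: riesz_mean_at_0[OF xp] norm_mult)
    also have "\<dots> \<le> x powr - k * (x powr k * (M * D) / p)"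
      using sum_le by (rule mult_left_mono) simp
    also have "\<dots> = (x powr - k * x powr k) * (D / p * M)" by simp
    also have "x powr - k * x powr k = 1" using xp by (simp flip: powr_add)
    finally show ?thesis using M(1) by (simp add: distrib_right)
  qed
  moreover have "0 < D / p + 1" using D p by (simp add: add_nonneg_pos)
  ultimately show thesis using that by blast
qed

section \<open>From the point 0 to the closed half plane\<close>

lemma riesz_mean_translate:
  "riesz_mean lam k (\<lambda>n. a n * exp (- of_real (lam n) * w)) x s = riesz_mean lam k a x (s + w)"
proof -
  have "exp (- of_real l * (s + w)) = exp (- of_real l * w) * exp (- of_real l * s)" for l
    by (simp add: algebra_simps flip: exp_add)
  then show ?thesis unfolding riesz_mean_def by (simp only: mult.assoc)
qed

lemma riesz_germ_translate:
  assumes "riesz_germ lam a f" "0 \<le> Re w"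
  shows "riesz_germ lam (\<lambda>n. a n * exp (- of_real (lam n) * w)) (\<lambda>s. f (s + w))"
proof -
  have hol: "f holomorphic_on right_half_plane 0"
    using assms(1) unfolding riesz_germ_def by blast
  have "(f \<circ> (\<lambda>s. s + w)) holomorphic_on right_half_plane 0"
    by (rule holomorphic_on_compose_gen[OF _ hol]) (use assms(2) in \<open>auto intro!: holomorphic_intros\<close>)
  moreover obtain m \<sigma> where "0 \<le> m" "0 \<le> \<sigma>" "\<And>s. \<sigma> < Re s \<Longrightarrow> ((\<lambda>x. riesz_mean lam m a x s) \<longlongrightarrow> f s) at_top"
    using assms(1) unfolding riesz_germ_def by auto
  ultimately show ?thesis
    unfolding riesz_germ_def riesz_mean_translate o_def using assms(2)
    by (intro conjI exI[of _ m] exI[of _ \<sigma>]) auto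
qed

text \<open>Two gaps remain after the estimate at 0. Parameters below \<open>lam 1\<close> leave at
  most the term of index 0, whose coefficient is read off from the mean at \<open>lam 1\<close>. A
  general point \<open>w\<close> is moved to 0 by translation, at the cost given by 1 + |s + w|
  \<le> (1 + |w|) (1 + |s|).\<close>

lemma riesz_mean_bound:
  assumes lam: "frequency lam" and l: "0 \<le> l" "l < k"
  obtains C where "0 < C"
    "\<And>a f M x w. riesz_germ lam a f \<Longrightarrow> 0 \<le> M \<Longrightarrow> (\<And>s. 0 < Re s \<Longrightarrow> cmod (f s) \<le> M * (1 + cmod s) powr l)
      \<Longrightarrow> 0 < x \<Longrightarrow> 0 \<le> Re w \<Longrightarrow> cmod (riesz_mean lam k a x w) \<le> C * M * (1 + cmod w) powr l"
proof -
  have mono: "strict_mono lam" using lam unfolding frequency_def by blast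
  have lam01: "lam 0 < lam 1" using strict_mono_less[OF mono] by simp
  have lam1: "0 < lam 1" using frequency_nonneg[OF lam, of 0] lam01 by linarith
  have idx: "{n. lam n < x} \<subseteq> {0}" if "x \<le> lam 1" for x
  proof
    fix n assume "n \<in> {n. lam n < x}"
    then have "lam n < lam 1" using that by simp
    then show "n \<in> {0}" using strict_mono_less[OF mono] by simp
  qed
  obtain C where C: "0 < C"
    "\<And>a f M x. riesz_germ lam a f \<Longrightarrow> 0 \<le> M \<Longrightarrow> (\<And>s. 0 < Re s \<Longrightarrow> cmod (f s) \<le> M * (1 + cmod s) powr l)
      \<Longrightarrow> lam 1 \<le> x \<Longrightarrow> cmod (riesz_mean lam k a x 0) \<le> C * M"
    using riesz_mean_at_0_bound[OF lam l lam1] by blast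
  \<comment> \<open>The weight of the only term in the mean at \<open>lam 1\<close>; dividing by it
    bounds \<open>a 0\<close>.\<close>
  define d where "d = (1 - lam 0 / lam 1) powr k"
  have d: "0 < d" "d \<le> 1"
    unfolding d_def using lam01 lam1 frequency_nonneg[OF lam, of 0] l by (auto intro!: powr_le1)
  have at0: "cmod (riesz_mean lam k a x 0) \<le> C / d * M"
    if germ: "riesz_germ lam a f" and M: "0 \<le> M" "\<And>s. 0 < Re s \<Longrightarrow> cmod (f s) \<le> M * (1 + cmod s) powr l" and x: "0 < x"
    for a f M x
  proof (cases "lam 1 \<le> x")
    case True
    have "C * M \<le> C / d * M"
      using C(1) d M(1) by (intro mult_right_mono) (auto simp: field_simps)
    then show ?thesis using C(2)[OF germ M True] by simp
  next
    case False
    have "{n. lam n < lam 1} = {0}" using idx[of "lam 1"] lam01 by auto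
    then have "riesz_mean lam k a (lam 1) 0 = a 0 * of_real d"
      unfolding riesz_mean_def d_def by simp
    then have "cmod (a 0) * d \<le> C * M"
      using C(2)[OF germ M order_refl] d by (simp add: norm_mult)
    then have a0: "cmod (a 0) \<le> C / d * M"
      using d by (simp add: field_simps)
    have "cmod (riesz_mean lam k a x 0) \<le> (\<Sum>n | lam n < x. cmod (a n))"
      unfolding riesz_mean_def
    proof (rule sum_norm_le)
      fix n assume "n \<in> {n. lam n < x}"
      then have "(1 - lam n / x) powr k \<le> 1"
        using frequency_nonneg[OF lam] l by (intro riesz_weight_le_one) auto
      then show "cmod (a n * exp (- of_real (lam n) * 0) * of_real ((1 - lam n / x) powr k)) \<le> cmod (a n)"
        by (simp add: norm_mult mult_left_le)
    qed
    also have "\<dots> \<le> (\<Sum>n\<in>{0}. cmod (a n))"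
      using False idx[of x] by (intro sum_mono2) auto
    finally show ?thesis using a0 by simp
  qed
  have "cmod (riesz_mean lam k a x w) \<le> C / d * M * (1 + cmod w) powr l"
    if germ: "riesz_germ lam a f" and M: "0 \<le> M" "\<And>s. 0 < Re s \<Longrightarrow> cmod (f s) \<le> M * (1 + cmod s) powr l"
      and x: "0 < x" and w: "0 \<le> Re w"
    for a f M x w
  proof -
    have "cmod (f (s + w)) \<le> M * (1 + cmod w) powr l * (1 + cmod s) powr l" if "0 < Re s" for s
    proof -
      have "1 + cmod (s + w) \<le> (1 + cmod w) * (1 + cmod s)"
      proof -
        have "0 \<le> cmod w * cmod s" by simp
        then show ?thesis
          unfolding distrib_left distrib_right mult_1_left mult_1_right
          using norm_triangle_ineq[of s w] by linarith
      qed
      then have "(1 + cmod (s + w)) powr l \<le> ((1 + cmod w) * (1 + cmod s)) powr l"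
        using l by (intro powr_mono2) auto
      then have "M * (1 + cmod (s + w)) powr l \<le> M * ((1 + cmod w) powr l * (1 + cmod s) powr l)"
        unfolding powr_mult using M(1) by (rule mult_left_mono)
      then show ?thesis using M(2)[of "s + w"] that w by (simp add: mult.assoc)
    qed
    from at0[OF riesz_germ_translate[OF germ w] _ this x] M(1)
    show ?thesis unfolding riesz_mean_translate by (simp add: mult.assoc)
  qed
  moreover have "0 < C / d" using C(1) d by simp
  ultimately show thesis using that by blast
qed

section \<open>Passage to the extended norm and the theorem\<close>

lemma H_norm_growth:
  assumes "H_norm l f < \<infinity>" "0 < Re s"
  shows "cmod (f s) \<le> enn2real (H_norm l f) * (1 + cmod s) powr l"
proof -
  have "ennreal (cmod (f s) / (1 + cmod s) powr l) \<le> H_norm l f"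
    unfolding H_norm_def using assms(2) by (intro SUP_upper) auto
  also have "\<dots> = ennreal (enn2real (H_norm l f))"
    using assms(1) by simp
  finally have "cmod (f s) / (1 + cmod s) powr l \<le> enn2real (H_norm l f)"
    by (simp add: ennreal_le_iff)
  moreover have "0 < 1 + cmod s" by (simp add: add_pos_nonneg)
  ultimately show ?thesis by (simp add: pos_divide_le_eq)
qed

theorem theorem3p6:
  fixes lam :: "nat \<Rightarrow> real" and k l :: real
  assumes "0 \<le> l" and "l < k" and "frequency lam"
  shows "(\<exists>C>0. \<forall>f\<in>H_space lam l.
            (SUP x\<in>{0<..}. H_norm l (R_mean lam k x f)) \<le> ennreal C * H_norm l f) \<and>
         (\<forall>\<sigma>\<ge>0. \<exists>C>0. \<forall>f\<in>H_space lam l. \<forall>t::real.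
            (SUP x\<in>{0<..}. ennreal (cmod (R_mean lam k x f (Complex \<sigma> t))))
              \<le> ennreal (C * (1 + \<bar>t\<bar>) powr l) * H_norm l f)"
proof -
  obtain C where C: "0 < C"
    "\<And>a f M x w. riesz_germ lam a f \<Longrightarrow> 0 \<le> M \<Longrightarrow> (\<And>s. 0 < Re s \<Longrightarrow> cmod (f s) \<le> M * (1 + cmod s) powr l)
      \<Longrightarrow> 0 < x \<Longrightarrow> 0 \<le> Re w \<Longrightarrow> cmod (riesz_mean lam k a x w) \<le> C * M * (1 + cmod w) powr l"
    using riesz_mean_bound[OF assms(3,1,2)] by blast
  have bound: "cmod (R_mean lam k x f w) \<le> C * enn2real (H_norm l f) * (1 + cmod w) powr l"
    if f: "f \<in> H_space lam l" and x: "0 < x" and w: "0 \<le> Re w" for f x w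
  proof -
    from f obtain a where a: "riesz_germ lam a f" and fin: "H_norm l f < \<infinity>"
      unfolding H_space_def by auto
    \<comment> \<open>Uniqueness of the germ turns the definite description into the given
      coefficient sequence.\<close>
    have "riesz_coeff lam f = a"
      unfolding riesz_coeff_def
      by (rule the_equality[where P = "\<lambda>a. riesz_germ lam a f", OF a])
        (rule riesz_germ_unique[OF assms(3) _ a assms(1) enn2real_nonneg H_norm_growth[OF fin]])
    then show ?thesis
      unfolding R_mean_def using C(2)[OF a enn2real_nonneg H_norm_growth[OF fin] x w] by simp
  qed
  have norm_eq: "H_norm l f = ennreal (enn2real (H_norm l f))" if "f \<in> H_space lam l" for f
    using that unfolding H_space_def by auto
  have "(SUP x\<in>{0<..}. H_norm l (R_mean lam k x f)) \<le> ennreal C * H_norm l f" if f: "f \<in> H_space lam l" for f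
  proof (rule SUP_least)
    fix x :: real assume x: "x \<in> {0<..}"
    show "H_norm l (R_mean lam k x f) \<le> ennreal C * H_norm l f"
      unfolding H_norm_def[of l "R_mean lam k x f"]
    proof (rule SUP_least)
      fix s assume "s \<in> right_half_plane 0"
      then have "cmod (R_mean lam k x f s) \<le> C * enn2real (H_norm l f) * (1 + cmod s) powr l"
        using x by (intro bound[OF f]) auto
      moreover have "0 < 1 + cmod s" by (simp add: add_pos_nonneg)
      ultimately have "cmod (R_mean lam k x f s) / (1 + cmod s) powr l \<le> C * enn2real (H_norm l f)"
        by (simp add: pos_divide_le_eq)
      then show "ennreal (cmod (R_mean lam k x f s) / (1 + cmod s) powr l) \<le> ennreal C * H_norm l f"
        using C(1) by (subst norm_eq[OF f]) (simp flip: ennreal_mult add: ennreal_leI)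
    qed
  qed
  moreover have "\<exists>C'>0. \<forall>f\<in>H_space lam l. \<forall>t::real.
      (SUP x\<in>{0<..}. ennreal (cmod (R_mean lam k x f (Complex \<sigma> t)))) \<le> ennreal (C' * (1 + \<bar>t\<bar>) powr l) * H_norm l f"
    if \<sigma>: "0 \<le> \<sigma>" for \<sigma>
  proof (intro exI conjI ballI allI SUP_least)
    \<comment> \<open>The additional factor stems from 1 + |\<sigma> + it| \<le> (1 + \<sigma>) (1 +
      |t|).\<close>
    show "0 < C * (1 + \<sigma>) powr l" using C(1) \<sigma> by simp
    fix f and t x :: real assume f: "f \<in> H_space lam l" and x: "x \<in> {0<..}"
    have "cmod (R_mean lam k x f (Complex \<sigma> t)) \<le> C * enn2real (H_norm l f) * (1 + \<sigma>) powr l * (1 + \<bar>t\<bar>) powr l"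
      using growth_on_strip[of l "C * enn2real (H_norm l f)" "Complex \<sigma> t" \<sigma> "R_mean lam k x f"]
        bound[OF f, of x "Complex \<sigma> t"] assms(1) C(1) \<sigma> x by simp
    then have "cmod (R_mean lam k x f (Complex \<sigma> t)) \<le> C * (1 + \<sigma>) powr l * (1 + \<bar>t\<bar>) powr l * enn2real (H_norm l f)"
      by (simp only: ac_simps)
    then show "ennreal (cmod (R_mean lam k x f (Complex \<sigma> t)))
        \<le> ennreal (C * (1 + \<sigma>) powr l * (1 + \<bar>t\<bar>) powr l) * H_norm l f"
      using C(1) by (subst norm_eq[OF f]) (simp flip: ennreal_mult add: ennreal_leI)
  qed
  ultimately show ?thesis using C(1) by blast
qed

end
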